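(* Let $M=\mathrm{QM}(f_1,\ldots,f_s)$ be a finitely generated quadratic module in $\mathbb{R}[X_1,\ldots,X_n,Y]$ and assume $N-\sum_{i=1}^nX_i^2\in M$ for some real $N>0$. Suppose that for all $r\in\mathbb{R}^n$ the set $S_r=\{y\in\mathbb{R}\mid f_1(r,y)\ge 0,\ldots,f_s(r,y)\ge 0\}$ is either empty or unbounded. Then $$M^{\ddagger}=\overline{M}$$ holds.
   Context: Let $A=\mathbb{R}[X_1,\ldots,X_n,Y]$. $\mathrm{QM}(f_1,\ldots,f_s)=\{\sigma_0+\sigma_1f_1+\cdots+\sigma_sf_s\mid\sigma_i\text{ sums of squares in }A\}$ is the quadratic module generated by $f_1,\ldots,f_s$. $M^{\ddagger}=\{f\in A\mid\exists q\in A\ \forall\varepsilon>0:\ f+\varepsilon q\in M\}$ (the sequential closure in the finest locally convex topology on $A$), and $\overline{M}=M^{\vee\vee}=\{f\in A\mid L(f)\ge 0\text{ for all linear }L\colon A\to\mathbb{R}\text{ with }L(M)\subseteq\mathbb{R}_{\ge 0}\}$ (the closure of $M$ in that topology). *)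

theory Defs
  imports "HOL-Analysis.Analysis" "HOL-Library.Poly_Mapping"
begin

(* A monomial is its exponent vector, a polynomial a finitely supported family of coefficients;
   multiplication of Poly_Mapping is the convolution product, so this is the polynomial ring
   over the reals in the indeterminates indexed by 'v.  For finite 'v, with one
   index Y :: 'v singled out, the remaining n = CARD('v) - 1 indices (possibly none) stand for
   X_1, ..., X_n. *)
type_synonym 'v rpoly = "('v \<Rightarrow>\<^sub>0 nat) \<Rightarrow>\<^sub>0 real"

definition Cst :: "real \<Rightarrow> 'v rpoly" where
  "Cst c = Poly_Mapping.single 0 c"

definition Var :: "'v \<Rightarrow> 'v rpoly" where
  "Var v = Poly_Mapping.single (Poly_Mapping.single v 1) 1"

definition peval :: "('v::finite \<Rightarrow> real) \<Rightarrow> 'v rpoly \<Rightarrow> real" where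
  "peval x p = (\<Sum>m\<in>Poly_Mapping.keys p.
      Poly_Mapping.lookup p m * (\<Prod>v\<in>UNIV. x v ^ Poly_Mapping.lookup m v))"

definition sos :: "'v rpoly set" where
  "sos = {\<Sum>i<k. (g i)\<^sup>2 | (k::nat) g. True}"

definition QM :: "nat \<Rightarrow> (nat \<Rightarrow> 'v rpoly) \<Rightarrow> 'v rpoly set" where
  "QM s f = {\<sigma> 0 + (\<Sum>i=1..s. \<sigma> i * f i) | \<sigma>. \<forall>i\<in>{0..s}. \<sigma> i \<in> sos}"

definition seq_closure :: "'v rpoly set \<Rightarrow> 'v rpoly set" where
  "seq_closure M = {f. \<exists>q. \<forall>\<epsilon>::real. \<epsilon> > 0 \<longrightarrow> f + Cst \<epsilon> * q \<in> M}"

definition linear_functional :: "('v rpoly \<Rightarrow> real) \<Rightarrow> bool" where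
  "linear_functional L \<longleftrightarrow> Vector_Spaces.linear (\<lambda>c p. Cst c * p) (*) L"

definition double_dual :: "'v rpoly set \<Rightarrow> 'v rpoly set" where
  "double_dual M =
     {f. \<forall>L. linear_functional L \<and> (\<forall>m\<in>M. 0 \<le> L m) \<longrightarrow> 0 \<le> L f}"

(* The locale predicate Vector_Spaces.linear also asserts the vector space axioms of both
   sides; they hold, so no content is hidden in linear_functional. *)
lemma vector_space_rpoly: "vector_space (\<lambda>c (p :: 'v rpoly). Cst c * p)"
  by unfold_locales
    (simp_all add: Cst_def algebra_simps single_add mult_single flip: mult.assoc one_poly_mapping.abs_eq)

lemma linear_functional_iff:
  "linear_functional L \<longleftrightarrow>
     (\<forall>p q. L (p + q) = L p + L q) \<and> (\<forall>c p. L (Cst c * p) = c * L p)"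
proof -
  have "vector_space ((*) :: real \<Rightarrow> real \<Rightarrow> real)"
    by unfold_locales (simp_all add: algebra_simps)
  then show ?thesis
    by (simp add: vector_space_rpoly linear_functional_def Vector_Spaces.linear_def module_hom_def
        module_hom_axioms_def module_iff_vector_space)
qed

(* The set S_r for r in R^n; here r is given as a point of R^(n+1) whose Y-coordinate is
   ignored. *)
definition fibre :: "nat \<Rightarrow> (nat \<Rightarrow> 'v::finite rpoly) \<Rightarrow> 'v \<Rightarrow> ('v \<Rightarrow> real) \<Rightarrow> real set" where
  "fibre s f Y r = {y. \<forall>i\<in>{1..s}. peval (r(Y := y)) (f i) \<ge> 0}"

end

theory Submission
  imports Defs "HOL-Computational_Algebra.Fundamental_Theorem_Algebra"
begin

text \<open>
  Let \<open>u\<close> lie in the double dual of \<open>M = QM s f\<close>, and let \<open>Q = 1 + Y\<^sup>2 + \<dots> + Y\<^sup>2\<^sup>h\<close> for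
  a large \<open>h\<close> that depends only on the \<open>Y\<close>-degrees of \<open>u\<close> and the \<open>f i\<close> and on \<open>s\<close>. The claim is that
  \<open>u + \<epsilon> Q\<close> lies in \<open>M\<close> for every \<open>\<epsilon> > 0\<close>, so that \<open>Q\<close> witnesses membership in the sequential closure.

  Suppose that \<open>u + \<epsilon> Q\<close> is not in \<open>M\<close>, and let \<open>V\<close> be the space of the polynomials of \<open>Y\<close>-degree at most
  \<open>2 h\<close>. Since the \<open>X\<close>-variables are bounded modulo \<open>M\<close>, the polynomial \<open>Q\<close> is an order unit of \<open>V\<close> for the cone
  \<open>M \<inter> V\<close>. The space \<open>V\<close> has countable dimension, so a functional \<open>L\<close> on \<open>V\<close> that is nonnegative on
  \<open>M \<inter> V\<close> and negative at \<open>u\<close> can be built one basis vector at a time. Always taking the least admissible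
  value makes \<open>L\<close> extreme (lemma \<open>extreme_functional\<close>). With \<open>c\<^sup>2 = N\<close>, multiplication by \<open>c + X\<^sub>i\<close> and
  \<open>c - X\<^sub>i\<close> preserves positivity of functionals: the moments \<open>L (X\<^sub>i\<^sup>2\<^sup>j t)\<close> are log-convex in \<open>j\<close> and grow at
  most like \<open>N\<^sup>j\<close>, which forces \<open>L (X\<^sub>i\<^sup>2 t) \<le> N L t\<close>. Hence the decomposition
  \<open>2 c L v = L ((c + X\<^sub>i) v) + L ((c - X\<^sub>i) v)\<close> of the extreme \<open>L\<close> must be trivial, each \<open>X\<^sub>i\<close> acts as a scalar \<open>r\<^sub>i\<close>,
  and \<open>L p = \<Lambda> (p(r, Y))\<close> for a functional \<open>\<Lambda>\<close> on univariate polynomials (lemma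
  \<open>fibre_functional\<close>). This replaces a measure disintegration over the compact ball of all \<open>r\<close>, and it is
  here that one bound \<open>h\<close> has to serve all fibres simultaneously.

  It remains to contradict \<open>\<Lambda> (u(r, Y)) < 0\<close> in the single fibre over \<open>r\<close>.

  If the fibre is empty, \<open>\<Lambda>\<close> vanishes on all polynomials of moderate degree (lemma
  \<open>vanishes_if_infeasible\<close>). Otherwise a Gauss quadrature for \<open>\<Lambda>\<close> has positive weights at real nodes, at
  each of which some \<open>f i(r, Y)\<close> is negative. By the pigeonhole principle one of them is negative at so many
  nodes that a polynomial \<open>g\<close> of admissible degree vanishes at all the others, and then
  \<open>\<Lambda> (g\<^sup>2 f i(r, Y)) < 0\<close>. The degrees needed depend only on \<open>s\<close> and the degrees of the \<open>f i\<close>, not on \<open>r\<close>.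

  If the fibre is unbounded, \<open>\<Lambda>\<close> restricted to the degree of \<open>u(r, Y)\<close> extends, after a small perturbation,
  to a functional on all univariate polynomials that is nonnegative on the quadratic module of the fibre
  (lemma \<open>extend_if_unbounded\<close>). The leading coefficients of the nonzero \<open>f i(r, Y)\<close> all have the sign that
  makes them positive near the same end of the real line, so positivity in the next degree only asks the next moment
  to be large in one and the same direction. Composing with \<open>p \<mapsto> p(r, Y)\<close> gives a functional that is
  nonnegative on \<open>M\<close> and negative at \<open>u\<close>, which contradicts the choice of \<open>u\<close>.
\<close>

section \<open>Positive functionals on univariate polynomials\<close>

lemma quadratic_form_nonneg:
  fixes a b c :: real
  assumes nonneg: "\<And>t. 0 \<le> t\<^sup>2 * a + 2 * t * b + c" and "0 \<le> a"
  shows "b\<^sup>2 \<le> a * c"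
proof (cases "a = 0")
  case True
  have "b = 0"
  proof (rule ccontr)
    assume "b \<noteq> 0"
    then show False
      using nonneg[of "- (c + 1) / (2 * b)"] True by (simp add: field_simps)
  qed
  then show ?thesis using True by simp
next
  case False
  then have "a > 0" using assms by simp
  then show ?thesis
    using nonneg[of "- b / a"] by (simp add: field_simps power2_eq_square)
qed

text \<open>
  Zero has degree \<open>0\<close>, so "degree less than \<open>n\<close>" would exclude the zero polynomial for \<open>n = 0\<close>; vanishing of the
  high coefficients gives a subspace of dimension \<open>n\<close> for every \<open>n\<close>.
\<close>
definition below :: "nat \<Rightarrow> real poly set" where
  "below n = {p. \<forall>i\<ge>n. coeff p i = 0}"

lemma below_iff: "p \<in> below n \<longleftrightarrow> p = 0 \<or> degree p < n"
proof
  assume *: "p \<in> below n"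
  show "p = 0 \<or> degree p < n"
  proof (rule ccontr)
    assume "\<not> ?thesis"
    then show False using * leading_coeff_0_iff[of p] by (auto simp: below_def not_less)
  qed
qed (auto simp: below_def coeff_eq_0)

lemma below_Suc_iff: "p \<in> below (Suc n) \<longleftrightarrow> degree p \<le> n"
  by (auto simp: below_iff less_Suc_eq_le)

lemma below_simps [simp]:
  "0 \<in> below n" "p \<in> below n \<Longrightarrow> q \<in> below n \<Longrightarrow> p + q \<in> below n"
  "p \<in> below n \<Longrightarrow> q \<in> below n \<Longrightarrow> p - q \<in> below n"
  "p \<in> below n \<Longrightarrow> - p \<in> below n"
  "p \<in> below n \<Longrightarrow> smult c p \<in> below n"
  by (auto simp: below_def)

lemma below_mono: "p \<in> below m \<Longrightarrow> m \<le> n \<Longrightarrow> p \<in> below n"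
  by (auto simp: below_def)

lemma below_SucI: "p \<in> below (Suc n) \<Longrightarrow> coeff p n = 0 \<Longrightarrow> p \<in> below n"
  by (auto simp: below_def) (metis Suc_leI le_eq_less_or_eq)

lemma map_poly_of_real_add:
  "map_poly complex_of_real (p + q) = map_poly complex_of_real p + map_poly complex_of_real q"
  by (rule poly_eqI) (simp add: coeff_map_poly)

lemma map_poly_of_real_mult:
  "map_poly complex_of_real (p * q) = map_poly complex_of_real p * map_poly complex_of_real q"
  by (rule poly_eqI) (simp add: coeff_map_poly coeff_mult)

lemma poly_map_poly_of_real:
  "poly (map_poly complex_of_real p) (complex_of_real x) = complex_of_real (poly p x)"
  by (induction p) (auto simp: map_poly_pCons)

text \<open>
  The forbidden factors are \<open>(Y - a)\<^sup>2 + b\<^sup>2\<close>. Every nonreal complex root would give one with \<open>b \<noteq> 0\<close>, and every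
  multiple real root one with \<open>b = 0\<close>; so all complex roots are real and simple.
\<close>
lemma card_roots_eq_degree:
  fixes p :: "real poly"
  assumes "p \<noteq> 0" and "\<And>a b r. p \<noteq> [:a\<^sup>2 + b\<^sup>2, - 2 * a, 1:] * r"
  shows "card {x. poly p x = 0} = degree p"
  using assms
proof (induction "degree p" arbitrary: p)
  case 0
  then obtain c where "p = [:c:]" using degree_eq_zeroE by metis
  then show ?case using 0 by auto
next
  case (Suc n)
  have "degree (map_poly complex_of_real p) > 0" using Suc by (simp add: degree_map_poly)
  then obtain z where z: "poly (map_poly complex_of_real p) z = 0"
    using alg_closed_imp_poly_has_root by blast
  have "Im z = 0"
  proof (rule ccontr)
    assume im: "Im z \<noteq> 0"
    define q where "q = [:(Re z)\<^sup>2 + (Im z)\<^sup>2, - 2 * Re z, 1:]"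
    have "degree (p mod q) < 2"
      using degree_mod_less[of q p] by (auto simp: q_def)
    then have "p mod q = [:coeff (p mod q) 0, coeff (p mod q) 1:]"
      by (intro poly_eqI) (auto simp: coeff_pCons coeff_eq_0 split: nat.splits)
    then obtain c0 c1 where r: "p mod q = [:c0, c1:]" by blast
    have q0: "poly (map_poly complex_of_real q) z = 0"
      by (simp add: q_def complex_eq_iff power2_eq_square map_poly_pCons algebra_simps)
    have "p = q * (p div q) + p mod q" by simp
    then have "map_poly complex_of_real p
        = map_poly complex_of_real q * map_poly complex_of_real (p div q) + map_poly complex_of_real (p mod q)"
      by (metis map_poly_of_real_add map_poly_of_real_mult)
    then have "poly (map_poly complex_of_real (p mod q)) z = 0"
      using z q0 by simp
    then have "c0 + Re z * c1 = 0 \<and> Im z * c1 = 0"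
      by (simp add: r map_poly_pCons complex_eq_iff)
    then have "p mod q = 0" using im r by auto
    then have "p = q * (p div q)" by (metis add.right_neutral mult_div_mod_eq)
    then show False using Suc.prems(2) unfolding q_def by blast
  qed
  then obtain x where "z = complex_of_real x" by (metis complex_is_Real_iff Reals_cases)
  then have "complex_of_real (poly p x) = 0" using z by (simp add: poly_map_poly_of_real)
  then have "poly p x = 0" by simp
  then obtain r where r: "p = [:- x, 1:] * r" by (metis poly_eq_0_iff_dvd dvdE)
  have "r \<noteq> 0" using r Suc.prems by auto
  then have "degree p = Suc (degree r)" using r degree_mult_eq[of "[:-x,1:]" r] by simp
  then have n: "n = degree r" using Suc by simp
  have "r \<noteq> [:a\<^sup>2 + b\<^sup>2, - 2 * a, 1:] * t" for a b t
  proof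
    assume "r = [:a\<^sup>2 + b\<^sup>2, - 2 * a, 1:] * t"
    then have "p = [:a\<^sup>2 + b\<^sup>2, - 2 * a, 1:] * ([:- x, 1:] * t)" using r by (simp only: ac_simps)
    then show False using Suc.prems(2) by blast
  qed
  then have card: "card {y. poly r y = 0} = degree r" using Suc n \<open>r \<noteq> 0\<close> by blast
  have "poly r x \<noteq> 0"
  proof
    assume "poly r x = 0"
    then obtain t where "r = [:- x, 1:] * t" by (metis poly_eq_0_iff_dvd dvdE)
    with r have "p = [:- x, 1:] * ([:- x, 1:] * t)" by simp
    then have "p = [:x\<^sup>2 + 0\<^sup>2, - 2 * x, 1:] * t"
      by (simp only: poly_eq_poly_eq_iff[symmetric] fun_eq_iff) (simp add: algebra_simps power2_eq_square)
    then show False using Suc.prems(2) by blast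
  qed
  moreover have "{y. poly p y = 0} = insert x {y. poly r y = 0}" using r by auto
  ultimately show ?case
    using card poly_roots_finite[OF \<open>r \<noteq> 0\<close>] \<open>degree p = Suc (degree r)\<close> by simp
qed

locale poly_functional =
  fixes L :: "real poly \<Rightarrow> real"
  assumes add: "L (p + q) = L p + L q" and smult: "L (smult c p) = c * L p"
begin

lemma zero [simp]: "L 0 = 0"
  using smult[of 0 0] by simp

lemma minus: "L (- p) = - L p"
  using smult[of "-1" p] by simp

lemma diff: "L (p - q) = L p - L q"
  using add[of p "- q"] by (simp add: minus)

lemma sum: "L (\<Sum>i\<in>A. g i) = (\<Sum>i\<in>A. L (g i))"
  by (induction A rule: infinite_finite_induct) (auto simp: add)

lemma times_fixed: "poly_functional (\<lambda>h. L (h * p))"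
  by unfold_locales (simp_all add: add smult distrib_right)

lemma Cauchy_Schwarz:
  assumes "\<And>t. 0 \<le> L ((smult t p + q) * (smult t p + q))" and "0 \<le> L (p * p)"
  shows "(L (p * q))\<^sup>2 \<le> L (p * p) * L (q * q)"
proof (rule quadratic_form_nonneg)
  fix t
  have "L ((smult t p + q) * (smult t p + q)) = t\<^sup>2 * L (p * p) + 2 * t * L (p * q) + L (q * q)"
    by (simp add: distrib_left distrib_right add smult mult.commute[of q p] power2_eq_square)
  then show "0 \<le> t\<^sup>2 * L (p * p) + 2 * t * L (p * q) + L (q * q)" using assms(1)[of t] by simp
qed (use assms in simp)

text \<open>
  Orthogonal projection for the inner product \<open>(g, h) \<mapsto> L (g * h)\<close> on polynomials of degree below \<open>n\<close>,
  by Gram-Schmidt along the degree.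
\<close>
lemma projection:
  assumes "\<And>g. g \<in> below n \<Longrightarrow> g \<noteq> 0 \<Longrightarrow> 0 < L (g * g)"
  shows "\<exists>q\<in>below n. \<forall>u\<in>below n. L ((h - q) * u) = 0"
  using assms
proof (induction n arbitrary: h)
  case 0
  then show ?case by (auto simp: below_iff)
next
  case (Suc n)
  have IH: "\<exists>q\<in>below n. \<forall>u\<in>below n. L ((h - q) * u) = 0" for h
    using Suc.IH Suc.prems below_mono[of _ n "Suc n"] by simp
  obtain q0 where q0: "q0 \<in> below n" "\<And>u. u \<in> below n \<Longrightarrow> L ((h - q0) * u) = 0"
    using IH[of h] by blast
  obtain e0 where e0: "e0 \<in> below n" "\<And>u. u \<in> below n \<Longrightarrow> L ((monom 1 n - e0) * u) = 0"
    using IH[of "monom 1 n"] by blast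
  define e where "e = monom 1 n - e0"
  have ce: "coeff e n = 1" using e0(1) by (simp add: e_def below_def)
  have eb: "e \<in> below (Suc n)"
    using e0(1) by (auto simp: e_def below_def)
  have "e \<noteq> 0" using ce by auto
  then have pos: "L (e * e) > 0" by (rule Suc.prems[OF eb])
  define c where "c = L ((h - q0) * e) / L (e * e)"
  show ?case
  proof (intro bexI[of _ "q0 + smult c e"] ballI)
    fix u assume u: "u \<in> below (Suc n)"
    define v where "v = u - smult (coeff u n) e"
    have v: "v \<in> below n"
      using u eb ce by (rule_tac below_SucI) (simp_all add: v_def)
    have "(h - (q0 + smult c e)) * u = (h - q0) * v - smult c (e * v)
        + smult (coeff u n) ((h - q0) * e - smult c (e * e))"
      unfolding v_def
      by (simp add: poly_eq_poly_eq_iff[symmetric] fun_eq_iff algebra_simps)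
    then have "L ((h - (q0 + smult c e)) * u)
        = L ((h - q0) * v) - c * L (e * v) + coeff u n * (L ((h - q0) * e) - c * L (e * e))"
      by (simp only: add diff smult)
    then show "L ((h - (q0 + smult c e)) * u) = 0"
      using q0(2)[OF v] e0(2)[OF v] pos by (simp add: e_def[symmetric] c_def)
  qed (use q0 eb below_mono[of q0 n "Suc n"] in simp)
qed

text \<open>
  The classical argument for the zeros of orthogonal polynomials: a factorization \<open>P = ((Y - a)\<^sup>2 + b\<^sup>2) r\<close> would
  give \<open>L (P r) = L (((Y - a) r)\<^sup>2) + b\<^sup>2 L (r\<^sup>2) > 0\<close>, although \<open>r\<close> has smaller degree than \<open>P\<close>.
\<close>
lemma orthogonal_card_roots:
  assumes pos: "\<And>g. g \<in> below n \<Longrightarrow> g \<noteq> 0 \<Longrightarrow> 0 < L (g * g)"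
    and P: "degree P = n" "P \<noteq> 0" "\<And>u. u \<in> below n \<Longrightarrow> L (P * u) = 0"
  shows "card {x. poly P x = 0} = n"
proof -
  have "P \<noteq> [:a\<^sup>2 + b\<^sup>2, - 2 * a, 1:] * r" for a b r
  proof
    assume eq: "P = [:a\<^sup>2 + b\<^sup>2, - 2 * a, 1:] * r"
    have r0: "r \<noteq> 0" using eq P by auto
    have n: "n = degree r + 2"
      using eq P(1) r0 degree_mult_eq[of "[:a\<^sup>2 + b\<^sup>2, - 2 * a, 1:]" r] by simp
    have r: "r \<in> below n" using n by (simp add: below_iff)
    have s: "[:- a, 1:] * r \<in> below n"
      unfolding below_iff n using degree_mult_eq[of "[:- a, 1:]" r] r0 by simp
    have "P * r = ([:- a, 1:] * r) * ([:- a, 1:] * r) + smult (b\<^sup>2) (r * r)"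
      unfolding eq by (simp add: poly_eq_poly_eq_iff[symmetric] fun_eq_iff algebra_simps power2_eq_square)
    then have "L (P * r) = L (([:- a, 1:] * r) * ([:- a, 1:] * r)) + b\<^sup>2 * L (r * r)"
      by (simp only: add smult)
    moreover have "L (([:- a, 1:] * r) * ([:- a, 1:] * r)) > 0"
      using s r0 by (intro pos) (auto simp del: mult_pCons_left)
    moreover have "L (r * r) > 0" using pos r r0 by blast
    ultimately show False using P(3)[OF r]
      by (smt (verit) mult_nonneg_nonneg zero_le_power2)
  qed
  then show ?thesis using card_roots_eq_degree P by blast
qed

end

section \<open>Functionals positive on infeasible weights\<close>

context poly_functional
begin

text \<open>
  Division by \<open>P\<close> reduces \<open>L h\<close> to the remainder, which Lagrange interpolation at the roots of \<open>P\<close> recovers from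
  the values of \<open>h\<close>. The weight of a node is \<open>L\<close> of its Lagrange polynomial \<open>l\<close>; applying the formula to \<open>l\<^sup>2\<close> shows
  that it equals \<open>L (l\<^sup>2)\<close> and is positive.
\<close>
lemma gauss_quadrature:
  assumes pos: "\<And>g. g \<in> below n \<Longrightarrow> g \<noteq> 0 \<Longrightarrow> 0 < L (g * g)"
    and P: "degree P = n" "P \<noteq> 0" "\<And>u. u \<in> below m \<Longrightarrow> L (P * u) = 0"
    and "n \<le> m"
  shows "\<exists>w. (\<forall>z. poly P z = 0 \<longrightarrow> 0 < w z) \<and>
    (\<forall>h\<in>below (n + m). L h = (\<Sum>z | poly P z = 0. w z * poly h z))"
proof -
  define Z where "Z = {z. poly P z = 0}"
  have finZ: "finite Z" unfolding Z_def by (rule poly_roots_finite[OF P(2)])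
  have cardZ: "card Z = n"
    unfolding Z_def using below_mono[OF _ \<open>n \<le> m\<close>] by (intro orthogonal_card_roots pos P) auto
  define l where "l z = (\<Prod>x\<in>Z - {z}. smult (1 / (z - x)) [:- x, 1:])" for z
  have l: "poly (l z) x = (if x = z then 1 else 0)" if "z \<in> Z" "x \<in> Z" for z x
    using that finZ by (auto simp: l_def poly_prod prod_zero_iff divide_simps intro!: prod.neutral)
  have degl: "degree (l z) \<le> n - 1" if "z \<in> Z" for z
  proof -
    have "degree (l z) \<le> (\<Sum>x\<in>Z - {z}. degree (smult (1 / (z - x)) [:- x, 1:]))"
      unfolding l_def by (rule degree_prod_sum_le[unfolded o_def]) (simp add: finZ)
    also have "\<dots> \<le> (\<Sum>x\<in>Z - {z}. 1)" by (intro sum_mono) simp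
    also have "\<dots> = n - 1" using finZ cardZ that by simp
    finally show ?thesis .
  qed
  have npos: "n > 0" if "z \<in> Z" for z using finZ cardZ that by (auto simp: card_gt_0_iff)
  have l_below: "l z \<in> below n" if "z \<in> Z" for z
    using degl[OF that] npos[OF that] by (auto simp: below_iff)
  have l_nz: "l z \<noteq> 0" if "z \<in> Z" for z using l[OF that that] by auto
  have formula: "L h = (\<Sum>z\<in>Z. L (l z) * poly h z)" if h: "h \<in> below (n + m)" for h
  proof -
    have hd: "h = P * (h div P) + h mod P" by simp
    have mod: "h mod P \<in> below n" using degree_mod_less[OF P(2), of h] P(1) by (simp add: below_iff)
    have "h div P \<in> below m"
    proof (cases "h div P = 0")
      case False
      have "P * (h div P) \<in> below (n + m)"
        using below_simps(3)[OF h below_mono[OF mod, of "n + m"]] hd by (metis add_diff_cancel_right' le_add1)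
      then have "degree (P * (h div P)) < n + m" using False P(2) by (simp add: below_iff)
      then show ?thesis using False P by (simp add: degree_mult_eq below_iff)
    qed simp
    then have "L (P * (h div P)) = 0" by (rule P(3))
    then have "L h = L (h mod P)" by (subst hd) (simp only: add)
    moreover have "h mod P = (\<Sum>z\<in>Z. smult (poly h z) (l z))" (is "_ = ?r")
    proof -
      have "?r \<in> below n"
        using finZ l_below by (induction rule: finite_subset_induct'[OF finZ subset_refl]) auto
      then have b: "h mod P - ?r \<in> below n" using mod by simp
      have "poly (h mod P - ?r) x = 0" if "x \<in> Z" for x
      proof -
        have "poly (h mod P) x = poly h x"
        proof -
          have "poly h x = poly P x * poly (h div P) x + poly (h mod P) x"
            by (simp flip: poly_mult poly_add)
          then show ?thesis using that by (simp add: Z_def)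
        qed
        moreover have "poly ?r x = (\<Sum>z\<in>Z. if z = x then poly h z else 0)"
          unfolding poly_sum by (rule sum.cong) (use l that in auto)
        ultimately show ?thesis using that finZ by simp
      qed
      moreover define e where "e = h mod P - ?r"
      ultimately have e: "e \<in> below n" "Z \<subseteq> {x. poly e x = 0}" using b by auto
      have "e = 0"
      proof (rule ccontr)
        assume e0: "e \<noteq> 0"
        have "card Z \<le> degree e"
          by (rule order_trans[OF card_mono[OF poly_roots_finite[OF e0] e(2)] card_poly_roots_bound[OF e0]])
        then show False using e(1) \<open>e \<noteq> 0\<close> cardZ by (simp add: below_iff)
      qed
      then show ?thesis by (simp add: e_def)
    qed
    ultimately show ?thesis by (simp add: sum smult mult.commute)
  qed
  have "0 < L (l z)" if z: "z \<in> Z" for z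
  proof -
    have "l z * l z \<in> below (n + m)"
      using degree_mult_le[of "l z" "l z"] degl[OF z] npos[OF z] \<open>n \<le> m\<close> by (auto simp: below_iff)
    then have "L (l z * l z) = (\<Sum>x\<in>Z. L (l x) * poly (l z * l z) x)" by (rule formula)
    also have "\<dots> = (\<Sum>x\<in>Z. if x = z then L (l x) else 0)"
      by (rule sum.cong) (use l z in auto)
    also have "\<dots> = L (l z)" using finZ z by simp
    finally show ?thesis using pos[OF l_below[OF z] l_nz[OF z]] by simp
  qed
  then show ?thesis using formula by (intro exI[of _ "\<lambda>z. L (l z)"]) (simp add: Z_def)
qed

text \<open>
  The product \<open>g\<close> of the linear factors of the nodes outside \<open>W\<close> kills all nodes where \<open>p\<close> may be nonnegative. The
  quadrature of \<open>g\<^sup>2 p\<close> is exact if \<open>W\<close> is large enough, and then has only negative terms.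
\<close>
lemma negative_on_nodes:
  assumes pos: "\<And>g. g \<in> below n \<Longrightarrow> g \<noteq> 0 \<Longrightarrow> 0 < L (g * g)"
    and P: "degree P = n" "P \<noteq> 0" "\<And>u. u \<in> below m \<Longrightarrow> L (P * u) = 0"
    and "n \<le> m"
    and W: "W = {z. poly P z = 0 \<and> poly p z < 0}" "W \<noteq> {}"
    and deg: "2 * (n - card W) + degree p < n + m"
  shows "\<exists>g\<in>below n. L (g * g * p) < 0"
proof -
  define Z where "Z = {z. poly P z = 0}"
  have finZ: "finite Z" unfolding Z_def by (rule poly_roots_finite[OF P(2)])
  have cardZ: "card Z = n"
    unfolding Z_def using below_mono[OF _ \<open>n \<le> m\<close>] by (intro orthogonal_card_roots pos P) auto
  have WZ: "W \<subseteq> Z" by (auto simp: W Z_def)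
  then have finW: "finite W" using finZ finite_subset by blast
  then have W0: "card W > 0" using W by (simp add: card_gt_0_iff)
  have WZn: "card W \<le> n" using card_mono[OF finZ WZ] cardZ by simp
  define g where "g = (\<Prod>x\<in>Z - W. [:- x, 1:])"
  have degg: "degree g = n - card W"
    unfolding g_def by (subst degree_prod_eq_sum_degree)
      (use WZ finZ finW cardZ in \<open>auto simp: card_Diff_subset\<close>)
  have "\<exists>w. (\<forall>z. poly P z = 0 \<longrightarrow> 0 < w z) \<and>
      (\<forall>h\<in>below (n + m). L h = (\<Sum>z\<in>Z. w z * poly h z))"
    unfolding Z_def by (rule gauss_quadrature) (fact pos P \<open>n \<le> m\<close>)+
  then obtain w where w: "\<forall>z. poly P z = 0 \<longrightarrow> 0 < w z"
    and quad: "\<forall>h\<in>below (n + m). L h = (\<Sum>z\<in>Z. w z * poly h z)"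
    by (elim exE conjE)
  have "degree (g * g * p) \<le> 2 * (n - card W) + degree p"
    using degree_mult_le[of "g * g" p] degree_mult_le[of g g] degg by simp
  then have "L (g * g * p) = (\<Sum>z\<in>Z. w z * poly (g * g * p) z)"
    using deg by (intro bspec[OF quad]) (simp add: below_iff)
  also have "\<dots> = (\<Sum>z\<in>W. w z * poly (g * g * p) z)"
    using WZ finZ by (intro sum.mono_neutral_right) (auto simp: g_def poly_prod prod_zero_iff)
  also have "\<dots> < (\<Sum>z\<in>W. 0)"
  proof (rule sum_strict_mono[OF finW W(2)])
    fix z assume z: "z \<in> W"
    then have "poly g z \<noteq> 0" using finZ by (auto simp: g_def poly_prod prod_zero_iff)
    then have "0 < poly g z * poly g z" by (meson not_real_square_gt_zero)
    moreover have "poly p z < 0" "0 < w z" using z w by (auto simp: W)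
    ultimately show "w z * poly (g * g * p) z < 0"
      by (simp add: mult_pos_neg)
  qed
  finally have "L (g * g * p) < 0" by simp
  moreover have "g \<in> below n" using degg W0 WZn by (simp add: below_iff)
  ultimately show ?thesis by blast
qed

text \<open>
  Assume \<open>L 1 \<noteq> 0\<close>. If \<open>L\<close> is positive definite below degree \<open>D\<close>, take for \<open>P\<close> the monic orthogonal polynomial of
  degree \<open>D\<close>: among its \<open>D\<close> nodes more than \<open>d\<close> are negative for the same \<open>p \<in> F\<close>. Otherwise take \<open>P\<close> of minimal
  degree with \<open>L (P\<^sup>2) = 0\<close>; by Cauchy-Schwarz it is orthogonal even to polynomials of degree well above its
  own, so that a single negative node suffices. Finally \<open>L 1 = 0\<close> forces \<open>L h = 0\<close> by Cauchy-Schwarz. The bound on \<open>D\<close>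
  involves only the number and the degrees of the weights, which makes it uniform over all fibres.
\<close>
lemma vanishes_if_infeasible:
  assumes F: "finite F" "\<And>p. p \<in> F \<Longrightarrow> degree p \<le> d" "\<And>y. \<exists>p\<in>F. poly p y < 0"
    and D: "card F * d < D"
    and squares: "\<And>g. g \<in> below (D + d + 1) \<Longrightarrow> 0 \<le> L (g * g)"
    and weighted: "\<And>g p. p \<in> F \<Longrightarrow> g \<in> below D \<Longrightarrow> 0 \<le> L (g * g * p)"
    and h: "h \<in> below (D + d + 1)"
  shows "L h = 0"
proof -
  have orth: "L (g * u) = 0" if "L (g * g) = 0" "g \<in> below (D + d + 1)" "u \<in> below (D + d + 1)" for g u
  proof -
    have "(L (g * u))\<^sup>2 \<le> L (g * g) * L (u * u)"
      by (rule Cauchy_Schwarz) (use that squares in auto)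
    then show ?thesis using that by simp
  qed
  have one: "1 \<in> below (D + d + 1)" by (simp add: below_iff)
  have "L 1 = 0"
  proof (rule ccontr)
    assume L1: "L 1 \<noteq> 0"
    show False
    proof (cases "\<forall>g\<in>below D. g \<noteq> 0 \<longrightarrow> 0 < L (g * g)")
      case True
      then have pos: "\<And>g. g \<in> below D \<Longrightarrow> g \<noteq> 0 \<Longrightarrow> 0 < L (g * g)" by blast
      then obtain q where q: "q \<in> below D" "\<And>u. u \<in> below D \<Longrightarrow> L ((monom 1 D - q) * u) = 0"
        using projection[of D "monom 1 D"] by blast
      define P where "P = monom 1 D - q"
      have "degree P \<le> D" using q(1) by (intro degree_le) (auto simp: P_def below_def)
      moreover have cP: "coeff P D = 1" using q(1) by (simp add: P_def below_def)
      ultimately have P: "degree P = D" "P \<noteq> 0"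
        using le_degree[of P D] by (auto intro!: antisym)
      have Pu: "\<And>u. u \<in> below D \<Longrightarrow> L (P * u) = 0" using q by (simp add: P_def)
      define W where "W p = {z. poly P z = 0 \<and> poly p z < 0}" for p
      have card: "card {z. poly P z = 0} = D" by (intro orthogonal_card_roots pos P Pu)
      have "\<exists>p\<in>F. d < card (W p)"
      proof (rule ccontr)
        assume "\<not> ?thesis"
        then have le: "\<And>p. p \<in> F \<Longrightarrow> card (W p) \<le> d" by force
        have "{z. poly P z = 0} = (\<Union>p\<in>F. W p)" using F(3) by (auto simp: W_def)
        then have "D \<le> (\<Sum>p\<in>F. card (W p))" using card card_UN_le[OF F(1), of W] by simp
        also have "\<dots> \<le> card F * d" using sum_bounded_above[of F "\<lambda>p. card (W p)" d] le by simp
        finally show False using D by simp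
      qed
      then obtain p where p: "p \<in> F" "d < card (W p)" by blast
      have "card (W p) \<le> D"
        using card_mono[OF poly_roots_finite[OF P(2)], of "W p"] card by (auto simp: W_def)
      moreover have "W p \<noteq> {}" using p(2) by auto
      ultimately have "\<exists>g\<in>below D. L (g * g * p) < 0"
        using p F(2)[OF p(1)]
        by (rule_tac negative_on_nodes[where m = D and W = "W p"]) (auto simp: pos P Pu W_def)
      then show False using weighted[OF p(1)] by force
    next
      case False
      define bad where "bad n \<longleftrightarrow> (\<exists>g. degree g = n \<and> n < D \<and> g \<noteq> 0 \<and> L (g * g) \<le> 0)" for n
      have "\<exists>n. bad n" using False by (force simp: bad_def below_iff)
      then have bad: "bad (Least bad)" by (rule LeastI_ex)
      define n where "n = Least bad"
      obtain P where P: "degree P = n" "n < D" "P \<noteq> 0" "L (P * P) \<le> 0"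
        using bad by (auto simp: bad_def n_def)
      have pos: "0 < L (g * g)" if "g \<in> below n" "g \<noteq> 0" for g
      proof (rule ccontr)
        assume "\<not> ?thesis"
        then have "bad (degree g)" using that P by (auto simp: bad_def below_iff)
        then show False using that not_less_Least[of "degree g" bad] by (simp add: n_def below_iff)
      qed
      have Pb: "P \<in> below (D + d + 1)" using P by (simp add: below_iff)
      have PP: "L (P * P) = 0" using squares[OF Pb] P by simp
      have Pu: "L (P * u) = 0" if "u \<in> below (D + d)" for u
        using orth[OF PP Pb] below_mono[OF that] by simp
      have "n > 0"
      proof (rule ccontr)
        assume "\<not> n > 0"
        then obtain c where c: "P = [:c:]" using P degree_eq_zeroE by auto
        then have "P * P = smult (c * c) 1" by simp
        then have "L (P * P) = c * c * L 1" by (simp only: smult)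
        then show False using PP L1 c P by simp
      qed
      have "n \<le> D + d" using P by simp
      have "card {z. poly P z = 0} = n"
        using P by (intro orthogonal_card_roots pos Pu) (auto intro: below_mono)
      then have "{z. poly P z = 0} \<noteq> {}" using \<open>n > 0\<close> by (metis card.empty less_numeral_extra(3))
      then obtain z p where z: "poly P z = 0" "p \<in> F" "poly p z < 0" using F(3) by blast
      define W where "W = {z. poly P z = 0 \<and> poly p z < 0}"
      have "finite W" using poly_roots_finite[OF P(3)] by (simp add: W_def)
      then have "card W > 0" using z by (auto simp: W_def card_gt_0_iff)
      then have deg: "2 * (n - card W) + degree p < n + (D + d)"
        using P(2) F(2)[OF z(2)] \<open>n > 0\<close> by linarith
      have "W \<noteq> {}" using z by (auto simp: W_def)
      then have "\<exists>g\<in>below n. L (g * g * p) < 0"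
        by (rule_tac negative_on_nodes[where m = "D + d" and W = W])
          (use deg \<open>n \<le> D + d\<close> pos P(1,3) Pu W_def in simp_all)
      then show False using weighted[OF z(2)] below_mono[of _ n D] P(2) by force
    qed
  qed
  then show ?thesis using orth[of 1 h] one h by simp
qed

end

section \<open>Extending functionals when the feasible set is unbounded\<close>

text \<open>
  For nonzero \<open>p\<close> the degree condition says that \<open>g\<^sup>2 p\<close> has degree at most \<open>n\<close>: only the truncation of \<open>L\<close> to that
  degree is constrained.
\<close>
definition strictly_positive :: "(real poly \<Rightarrow> real) \<Rightarrow> real poly set \<Rightarrow> nat \<Rightarrow> bool" where
  "strictly_positive L F n \<longleftrightarrow>
     (\<forall>p\<in>F. \<forall>g. g \<noteq> 0 \<longrightarrow> 2 * degree g + degree p \<le> n \<longrightarrow> 0 < L (g * g * p))"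

context poly_functional
begin

lemma add_coeff: "poly_functional (\<lambda>h. L h + t * coeff h n)"
  by unfold_locales (simp_all add: add smult algebra_simps)

text \<open>
  Adding \<open>t\<close> times the coefficient of degree \<open>n + 1\<close> changes only the next moment. Let \<open>g\<^sup>2 p\<close> have degree exactly
  \<open>n + 1\<close>. Projecting the leading monomial of \<open>g\<close> away from lower degrees bounds \<open>L (g\<^sup>2 p)\<close> from below by a
  multiple of the square of the leading coefficient of \<open>g\<close>, with a factor depending on \<open>p\<close> only. As the
  leading coefficients of all these products have the sign of \<open>\<theta> ^ (n + 1)\<close>, one \<open>t\<close> of that sign and of large
  absolute value repairs all \<open>p \<in> F\<close> at once.
\<close>
lemma strictly_positive_Suc:
  assumes F: "finite F" "0 \<notin> F"
    and \<theta>: "\<theta> = 1 \<or> \<theta> = -1" "\<forall>p\<in>F. 0 < \<theta> ^ degree p * lead_coeff p"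
    and pos: "strictly_positive L F n"
  shows "\<exists>t. strictly_positive (\<lambda>h. L h + t * coeff h (Suc n)) F (Suc n)"
proof -
  \<comment> \<open>A lower bound that is uniform in \<open>g\<close>: the minimum over monic \<open>g\<close> is attained at the
    leading monomial minus its orthogonal projection to lower degrees.\<close>
  have "\<exists>c. \<forall>g. g \<noteq> 0 \<longrightarrow> 2 * degree g + degree p = Suc n \<longrightarrow> c * (lead_coeff g)\<^sup>2 \<le> L (g * g * p)"
    if p: "p \<in> F" for p
  proof (cases "\<exists>m. 2 * m + degree p = Suc n")
    case True
    then obtain m where m: "2 * m + degree p = Suc n" by blast
    interpret M: poly_functional "\<lambda>h. L (h * p)" by (rule times_fixed)
    have "0 < L (g * g * p)" if "g \<in> below m" "g \<noteq> 0" for g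
      using pos p that m by (auto simp: strictly_positive_def below_iff)
    then obtain q where q: "q \<in> below m" "\<And>u. u \<in> below m \<Longrightarrow> L ((monom 1 m - q) * u * p) = 0"
      using M.projection[of m "monom 1 m"] by blast
    define e where "e = monom 1 m - q"
    have ce: "coeff e m = 1" using q(1) by (simp add: e_def below_def)
    have eb: "e \<in> below (Suc m)" using q(1) by (auto simp: e_def below_def)
    have "L (e * e * p) * (lead_coeff g)\<^sup>2 \<le> L (g * g * p)"
      if g: "g \<noteq> 0" "2 * degree g + degree p = Suc n" for g
    proof -
      define a where "a = lead_coeff g"
      define v where "v = g - smult a e"
      have dg: "degree g = m" using g m by simp
      have v: "v \<in> below m"
        using dg eb ce by (rule_tac below_SucI) (simp_all add: v_def a_def below_Suc_iff[of g])
      have "g = v + smult a e" by (simp add: v_def)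
      then have "g * g * p = v * v * p + smult (2 * a) (e * v * p) + smult (a\<^sup>2) (e * e * p)"
        by (simp only: poly_eq_poly_eq_iff[symmetric] fun_eq_iff) (simp add: algebra_simps power2_eq_square)
      then have "L (g * g * p) = L (v * v * p) + 2 * a * L (e * v * p) + a\<^sup>2 * L (e * e * p)"
        by (simp only: add smult)
      moreover have "L (e * v * p) = 0" using q(2)[OF v] by (simp add: e_def)
      moreover have "0 \<le> L (v * v * p)"
        using pos p v m by (cases "v = 0") (auto simp: strictly_positive_def below_iff intro!: less_imp_le)
      ultimately show ?thesis by (simp add: a_def mult.commute)
    qed
    then show ?thesis by blast
  qed blast
  then obtain c where c: "\<And>p g. p \<in> F \<Longrightarrow> g \<noteq> 0 \<Longrightarrow> 2 * degree g + degree p = Suc n \<Longrightarrow>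
      c p * (lead_coeff g)\<^sup>2 \<le> L (g * g * p)"
    by metis
  define T where "T = 1 + (\<Sum>p\<in>F. \<bar>c p\<bar> / \<bar>lead_coeff p\<bar>)"
  have T: "0 < c p + T * \<bar>lead_coeff p\<bar>" if p: "p \<in> F" for p
  proof -
    have l: "\<bar>lead_coeff p\<bar> > 0" using p F by auto
    have "\<bar>c p\<bar> / \<bar>lead_coeff p\<bar> \<le> (\<Sum>p\<in>F. \<bar>c p\<bar> / \<bar>lead_coeff p\<bar>)"
      using F p by (intro member_le_sum) auto
    then have "\<bar>c p\<bar> / \<bar>lead_coeff p\<bar> < T" by (simp add: T_def)
    then show ?thesis using l by (simp add: divide_less_eq)
  qed
  have "strictly_positive (\<lambda>h. L h + T * \<theta> ^ Suc n * coeff h (Suc n)) F (Suc n)"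
    unfolding strictly_positive_def
  proof (intro ballI allI impI)
    fix p g
    assume p: "p \<in> F" and g: "g \<noteq> (0 :: real poly)" and deg: "2 * degree g + degree p \<le> Suc n"
    have p0: "p \<noteq> 0" using p F by blast
    have dgp: "degree (g * g * p) = 2 * degree g + degree p" using g p0 by (simp add: degree_mult_eq)
    show "0 < L (g * g * p) + T * \<theta> ^ Suc n * coeff (g * g * p) (Suc n)"
    proof (cases "2 * degree g + degree p = Suc n")
      case True
      have "coeff (g * g * p) (Suc n) = lead_coeff (g * g * p)" using dgp True by simp
      also have "\<dots> = (lead_coeff g)\<^sup>2 * lead_coeff p" by (simp only: lead_coeff_mult power2_eq_square)
      finally have co: "coeff (g * g * p) (Suc n) = (lead_coeff g)\<^sup>2 * lead_coeff p" .
      have "\<theta> ^ Suc n = \<theta> ^ degree p"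
        using \<theta>(1) unfolding True[symmetric] power_add power_mult by auto
      moreover have "\<bar>\<theta> ^ degree p * lead_coeff p\<bar> = \<bar>lead_coeff p\<bar>"
        using \<theta>(1) by (auto simp: abs_mult power_abs)
      ultimately have th: "\<theta> ^ Suc n * lead_coeff p = \<bar>lead_coeff p\<bar>"
        using bspec[OF \<theta>(2) p] by simp
      have "0 < (lead_coeff g)\<^sup>2 * (c p + T * \<bar>lead_coeff p\<bar>)"
        using g T[OF p] by (intro mult_pos_pos) auto
      also have "\<dots> = c p * (lead_coeff g)\<^sup>2 + T * (lead_coeff g)\<^sup>2 * (\<theta> ^ Suc n * lead_coeff p)"
        unfolding th by (simp add: algebra_simps)
      also have "\<dots> \<le> L (g * g * p) + T * (lead_coeff g)\<^sup>2 * (\<theta> ^ Suc n * lead_coeff p)"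
        using c[OF p g True] by simp
      finally show ?thesis unfolding co by (simp only: ac_simps)
    next
      case False
      then have le: "2 * degree g + degree p \<le> n" using deg by simp
      then have "coeff (g * g * p) (Suc n) = 0" using dgp by (intro coeff_eq_0) simp
      then show ?thesis using pos p g le by (simp add: strictly_positive_def)
    qed
  qed
  then show ?thesis by blast
qed

text \<open>
  Iterating the previous step gives functionals that change only in higher and higher degrees, hence stabilize on every
  polynomial.
\<close>
lemma extend_strictly_positive:
  assumes F: "finite F" "0 \<notin> F"
    and \<theta>: "\<theta> = 1 \<or> \<theta> = -1" "\<forall>p\<in>F. 0 < \<theta> ^ degree p * lead_coeff p"
    and pos: "strictly_positive L F n"
  obtains L' where "poly_functional L'" "\<And>h. h \<in> below (Suc n) \<Longrightarrow> L' h = L h"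
    "\<And>p g. p \<in> F \<Longrightarrow> 0 \<le> L' (g * g * p)"
proof -
  have "\<exists>G. \<forall>k. (poly_functional (G k) \<and> strictly_positive (G k) F (n + k) \<and> (k = 0 \<longrightarrow> G k = L)) \<and>
      (\<exists>t. G (Suc k) = (\<lambda>h. G k h + t * coeff h (Suc (n + k))))"
  proof (rule dependent_nat_choice)
    show "\<exists>G. poly_functional G \<and> strictly_positive G F (n + 0) \<and> (0 = 0 \<longrightarrow> G = L)"
      using pos poly_functional_axioms by auto
  next
    fix G k
    assume "poly_functional G \<and> strictly_positive G F (n + k) \<and> (k = 0 \<longrightarrow> G = L)"
    then interpret G: poly_functional G by blast
    have "strictly_positive G F (n + k)"
      using \<open>poly_functional G \<and> strictly_positive G F (n + k) \<and> (k = 0 \<longrightarrow> G = L)\<close> by blast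
    then obtain t where "strictly_positive (\<lambda>h. G h + t * coeff h (Suc (n + k))) F (Suc (n + k))"
      using G.strictly_positive_Suc[OF F \<theta>] by blast
    then show "\<exists>G'. (poly_functional G' \<and> strictly_positive G' F (n + Suc k) \<and> (Suc k = 0 \<longrightarrow> G' = L)) \<and>
        (\<exists>t. G' = (\<lambda>h. G h + t * coeff h (Suc (n + k))))"
      using G.add_coeff by auto
  qed
  then obtain G where G: "\<And>k. poly_functional (G k)" "\<And>k. strictly_positive (G k) F (n + k)" "G 0 = L"
    "\<And>k. \<exists>t. G (Suc k) = (\<lambda>h. G k h + t * coeff h (Suc (n + k)))"
    by blast
  have stable_Suc: "G (Suc k) h = G k h" if "degree h \<le> n + k" for k h
    using G(4)[of k] that by (auto simp: coeff_eq_0)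
  have stable: "G j h = G k h" if "degree h \<le> n + k" "k \<le> j" for j k h
    using that(2,1) by (induction j rule: dec_induct) (simp_all add: stable_Suc)
  define L' where "L' h = G (degree h) h" for h
  have L': "L' h = G j h" if "degree h \<le> j" for h j
    unfolding L'_def using stable[of h "degree h" j] that by simp
  have "poly_functional L'"
  proof
    fix p q :: "real poly" and c :: real
    define j where "j = max (degree p) (degree q)"
    interpret Gj: poly_functional "G j" by (rule G(1))
    have "L' (p + q) = G j (p + q)" by (intro L') (simp add: j_def degree_add_le_max)
    then show "L' (p + q) = L' p + L' q"
      using L'[of p j] L'[of q j] Gj.add[of p q] by (simp add: j_def)
    have "L' (smult c p) = G j (smult c p)"
      by (intro L') (simp add: j_def)
    then show "L' (smult c p) = c * L' p"
      using L'[of p j] Gj.smult[of c p] by (simp add: j_def)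
  qed
  moreover have "L' h = L h" if "h \<in> below (Suc n)" for h
    unfolding L'_def using stable[of h 0 "degree h"] that G(3) by (simp add: below_Suc_iff)
  moreover have "0 \<le> L' (g * g * p)" if "p \<in> F" for p g
  proof (cases "g = 0")
    case True
    then show ?thesis using L'[of 0 0] G(3) by simp
  next
    case False
    define j where "j = 2 * degree g + degree p"
    have "degree (g * g * p) \<le> j"
      unfolding j_def using degree_mult_le[of "g * g" p] degree_mult_le[of g g] by simp
    then have "L' (g * g * p) = G j (g * g * p)" by (rule L')
    then show ?thesis
      using G(2)[of j] that False by (auto simp: strictly_positive_def j_def intro: less_imp_le)
  qed
  ultimately show ?thesis by (rule that)
qed

end

lemma bounded_if_bdd_above_below:
  fixes S :: "real set"
  assumes "bdd_above S" "bdd_below S"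
  shows "bounded S"
proof -
  obtain a b where "\<And>x. x \<in> S \<Longrightarrow> a \<le> x \<and> x \<le> b" using assms unfolding bdd_above_def bdd_below_def by blast
  then have "S \<subseteq> {a..b}" by auto
  then show ?thesis using bounded_closed_interval bounded_subset by blast
qed

lemma lead_coeff_nonneg_if_often_nonneg:
  fixes p :: "real poly"
  assumes "\<not> bdd_above {y. 0 \<le> poly p y}"
  shows "0 \<le> lead_coeff p"
proof (rule ccontr)
  assume "\<not> ?thesis"
  then have "0 < lead_coeff (- p)" by simp
  then obtain b where "\<And>x. b \<le> x \<Longrightarrow> lead_coeff (- p) \<le> poly (- p) x" using poly_pinfty_gt_lc by blast
  then have "\<And>x. b \<le> x \<Longrightarrow> poly p x < 0" using \<open>0 < lead_coeff (- p)\<close> by (smt (verit) poly_minus)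
  then have "{y. 0 \<le> poly p y} \<subseteq> {..b}" by (auto simp: not_le[symmetric]) (meson linorder_le_cases not_le)
  then have "bdd_above {y. 0 \<le> poly p y}" by (rule bdd_above_mono[OF bdd_above_Iic])
  then show False using assms by simp
qed

text \<open>
  Here \<open>\<theta>\<close> tells at which end of the real line the set is unbounded; \<open>\<theta> ^ degree p * lead_coeff p\<close> is the sign of \<open>p\<close>
  there.
\<close>
lemma leading_signs_if_unbounded:
  assumes "0 \<notin> F" and unb: "\<not> bounded {y. \<forall>p\<in>F. 0 \<le> poly p y}"
  shows "\<exists>\<theta>::real. (\<theta> = 1 \<or> \<theta> = -1) \<and> (\<forall>p\<in>F. 0 < \<theta> ^ degree p * lead_coeff p)"
proof -
  let ?S = "{y. \<forall>p\<in>F. 0 \<le> poly p y}"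
  have "\<not> bdd_above ?S \<or> \<not> bdd_below ?S"
    using unb bounded_if_bdd_above_below by blast
  then show ?thesis
  proof
    assume up: "\<not> bdd_above ?S"
    have "0 < lead_coeff p" if "p \<in> F" for p
    proof -
      have "?S \<subseteq> {y. 0 \<le> poly p y}" using that by blast
      then have "\<not> bdd_above {y. 0 \<le> poly p y}" using up by (metis bdd_above_mono)
      then have "0 \<le> lead_coeff p" by (rule lead_coeff_nonneg_if_often_nonneg)
      then show ?thesis using that assms(1) by (auto simp: order_le_less)
    qed
    then show ?thesis by (intro exI[of _ 1]) simp
  next
    assume down: "\<not> bdd_below ?S"
    have "0 < (-1) ^ degree p * lead_coeff p" if "p \<in> F" for p
    proof -
      have sub: "uminus ` ?S \<subseteq> {y. 0 \<le> poly (pcompose p [:0, -1:]) y}" using that by (auto simp: poly_pcompose)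
      have "\<not> bdd_above (uminus ` ?S)" using down by simp
      then have "\<not> bdd_above {y. 0 \<le> poly (pcompose p [:0, -1:]) y}" using bdd_above_mono[OF _ sub] by (rule contrapos_nn)
      then have "0 \<le> lead_coeff (pcompose p [:0, -1:])" by (rule lead_coeff_nonneg_if_often_nonneg)
      also have "lead_coeff (pcompose p [:0, -1:]) = lead_coeff p * (-1) ^ degree p"
        by (subst lead_coeff_comp) auto
      finally show ?thesis using that assms(1) by (auto simp: order_le_less mult.commute)
    qed
    then show ?thesis by (intro exI[of _ "-1"]) simp
  qed
qed

text \<open>
  Strict positivity, which the step from one degree to the next needs, is obtained by adding a small multiple of the sum
  of the evaluations at more than \<open>n\<close> points where all \<open>p \<in> F\<close> are positive; no nonzero \<open>g\<close> of the
  relevant degree vanishes at all of them.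
\<close>
lemma (in poly_functional) extend_if_unbounded:
  assumes F: "finite F" "0 \<notin> F"
    and unb: "\<not> bounded {y. \<forall>p\<in>F. 0 \<le> poly p y}"
    and nonneg: "\<And>p g. p \<in> F \<Longrightarrow> 2 * degree g + degree p \<le> n \<Longrightarrow> 0 \<le> L (g * g * p)"
    and h: "degree h \<le> n" "L h < 0"
  obtains L' where "poly_functional L'" "\<And>p g. p \<in> F \<Longrightarrow> 0 \<le> L' (g * g * p)" "L' h < 0"
proof -
  let ?S = "{y. \<forall>p\<in>F. 0 \<le> poly p y}"
  have inf: "infinite (?S - (\<Union>p\<in>F. {y. poly p y = 0}))"
  proof -
    have "finite (\<Union>p\<in>F. {y. poly p y = 0})"
      using F by (intro finite_UN_I poly_roots_finite) auto
    moreover have "infinite ?S" using unb finite_imp_bounded by blast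
    ultimately show ?thesis by simp
  qed
  obtain A where A: "finite A" "card A = Suc n" "A \<subseteq> ?S - (\<Union>p\<in>F. {y. poly p y = 0})"
    using infinite_arbitrarily_large[OF inf] by blast
  define E where "E q = (\<Sum>y\<in>A. poly q y)" for q
  have Epos: "0 < E (g * g * p)" if p: "p \<in> F" and g: "g \<noteq> 0" and deg: "2 * degree g + degree p \<le> n" for p g
  proof -
    have pp: "0 < poly p y" if "y \<in> A" for y
      using that A(3) p by (force simp: order_le_less)
    have "\<not> A \<subseteq> {y. poly g y = 0}"
    proof
      assume "A \<subseteq> {y. poly g y = 0}"
      then have "card A \<le> degree g"
        using card_mono[OF poly_roots_finite[OF g]] card_poly_roots_bound[OF g] le_trans by blast
      then show False using A deg by simp
    qed
    then obtain y where y: "y \<in> A" "poly g y \<noteq> 0" by blast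
    have "0 < poly (g * g * p) y"
      using pp[OF y(1)] y(2) by (auto simp: zero_less_mult_iff linorder_neq_iff)
    moreover have "0 \<le> poly (g * g * p) x" if "x \<in> A" for x
      using pp[OF that] by simp
    ultimately show ?thesis unfolding E_def using A y by (intro sum_pos2[of A y]) auto
  qed
  define \<delta> where "\<delta> = - L h / (2 * (1 + \<bar>E h\<bar>))"
  have \<delta>: "0 < \<delta>" unfolding \<delta>_def using h by (intro divide_pos_pos) auto
  have "\<delta> * \<bar>E h\<bar> \<le> - L h / 2"
    unfolding \<delta>_def using h by (simp add: field_simps)
  then have neg: "L h + \<delta> * E h < 0"
    using h \<delta> mult_left_mono[of "E h" "\<bar>E h\<bar>" \<delta>] by linarith
  interpret M: poly_functional "\<lambda>q. L q + \<delta> * E q"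
    by unfold_locales (simp_all add: E_def add smult sum.distrib sum_distrib_left algebra_simps)
  have sp: "strictly_positive (\<lambda>q. L q + \<delta> * E q) F n"
    unfolding strictly_positive_def
    using nonneg Epos \<delta> by (auto intro!: add_nonneg_pos)
  obtain \<theta> :: real where \<theta>: "\<theta> = 1 \<or> \<theta> = -1" "\<forall>p\<in>F. 0 < \<theta> ^ degree p * lead_coeff p"
    using leading_signs_if_unbounded[OF F(2) unb] by blast
  show ?thesis
  proof (rule M.extend_strictly_positive[OF F \<theta> sp])
    fix L'
    assume L': "poly_functional L'" "\<And>h. h \<in> below (Suc n) \<Longrightarrow> L' h = L h + \<delta> * E h"
      "\<And>p g. p \<in> F \<Longrightarrow> 0 \<le> L' (g * g * p)"
    have "L' h < 0" using L'(2)[of h] neg h(1) by (simp add: below_Suc_iff)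
    then show ?thesis using that[of L'] L'(1,3) by blast
  qed
qed

section \<open>Extreme positive functionals for cones with an order unit\<close>

locale real_space = vector_space scale
  for scale :: "real \<Rightarrow> 'a::ab_group_add \<Rightarrow> 'a" (infixr "\<cdot>" 75)
begin

definition linear_on :: "'a set \<Rightarrow> ('a \<Rightarrow> real) \<Rightarrow> bool" where
  "linear_on V L \<longleftrightarrow> (\<forall>u\<in>V. \<forall>v\<in>V. L (u + v) = L u + L v) \<and> (\<forall>c. \<forall>v\<in>V. L (c \<cdot> v) = c * L v)"

definition wedge :: "'a set \<Rightarrow> bool" where
  "wedge T \<longleftrightarrow> (\<forall>u\<in>T. \<forall>v\<in>T. u + v \<in> T) \<and> (\<forall>c\<ge>0. \<forall>u\<in>T. c \<cdot> u \<in> T)"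

text \<open>
  The condition \<open>- Q \<notin> T\<close> makes the cone proper in the strong sense that \<open>c \<cdot> Q \<in> T\<close> only for \<open>c \<ge> 0\<close>, which is what
  survives the passage to larger cones below.
\<close>
definition order_unit_cone :: "'a set \<Rightarrow> 'a \<Rightarrow> 'a set \<Rightarrow> bool" where
  "order_unit_cone V Q T \<longleftrightarrow> subspace V \<and> T \<subseteq> V \<and> wedge T \<and> Q \<in> T \<and> - Q \<notin> T \<and>
     (\<forall>v\<in>V. \<exists>c. c \<cdot> Q + v \<in> T)"

definition extreme_on :: "'a set \<Rightarrow> 'a set \<Rightarrow> ('a \<Rightarrow> real) \<Rightarrow> bool" where
  "extreme_on V T L \<longleftrightarrow> (\<forall>L1 L2. linear_on V L1 \<longrightarrow> linear_on V L2 \<longrightarrow>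
     (\<forall>t\<in>T. 0 \<le> L1 t) \<longrightarrow> (\<forall>t\<in>T. 0 \<le> L2 t) \<longrightarrow> (\<forall>v\<in>V. L1 v + L2 v = L v) \<longrightarrow>
     (\<exists>\<alpha>. \<forall>v\<in>V. L1 v = \<alpha> * L v))"

text \<open>
  The negative of the least value that a functional nonnegative on \<open>T\<close> and normalized at \<open>Q\<close> may take at \<open>v\<close>.
\<close>
definition threshold :: "'a set \<Rightarrow> 'a \<Rightarrow> 'a \<Rightarrow> real" where
  "threshold T Q v = Inf {l. l \<cdot> Q + v \<in> T}"

text \<open>
  Each step adjoins a line to the cone and thereby forces the next functional value to be the least possible
  one. A functional that is normalized at \<open>Q\<close> is nonnegative on the whole chain if and only if it takes these values
  and is nonnegative on \<open>T\<close>.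
\<close>
primrec chain :: "'a set \<Rightarrow> 'a \<Rightarrow> (nat \<Rightarrow> 'a) \<Rightarrow> nat \<Rightarrow> 'a set" where
  "chain T Q e 0 = T"
| "chain T Q e (Suc n) = {t + c \<cdot> (threshold (chain T Q e n) Q (e n) \<cdot> Q + e n) | t c. t \<in> chain T Q e n}"

lemma wedgeD:
  assumes "wedge T"
  shows "u \<in> T \<Longrightarrow> v \<in> T \<Longrightarrow> u + v \<in> T" "0 \<le> c \<Longrightarrow> u \<in> T \<Longrightarrow> c \<cdot> u \<in> T"
  using assms by (auto simp: wedge_def)

lemma multiple_of_unit_nonneg:
  assumes T: "order_unit_cone V Q T" and "c \<cdot> Q \<in> T"
  shows "0 \<le> c"
proof (rule ccontr)
  assume "\<not> 0 \<le> c"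
  then have "(- inverse c) \<cdot> c \<cdot> Q \<in> T"
    using assms by (rule_tac wedgeD(2)[of T]) (auto simp: order_unit_cone_def)
  then have "- Q \<in> T" using \<open>\<not> 0 \<le> c\<close> by simp
  then show False using T by (simp add: order_unit_cone_def)
qed

lemma threshold_bdd_below:
  assumes T: "order_unit_cone V Q T" and v: "v \<in> V"
  shows "bdd_below {l. l \<cdot> Q + v \<in> T}"
proof -
  have "- v \<in> V" using T v subspace_neg by (auto simp: order_unit_cone_def)
  then obtain c where c: "c \<cdot> Q + - v \<in> T" using T by (auto simp: order_unit_cone_def)
  have "- c \<le> l" if "l \<cdot> Q + v \<in> T" for l
  proof -
    have "(l \<cdot> Q + v) + (c \<cdot> Q + - v) \<in> T"
      using that c T wedgeD(1) unfolding order_unit_cone_def by blast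
    then have "(l + c) \<cdot> Q \<in> T" by (simp add: scale_left_distrib)
    then show ?thesis using multiple_of_unit_nonneg[OF T] by fastforce
  qed
  then show ?thesis by (auto simp: bdd_below_def)
qed

lemma above_threshold:
  assumes T: "order_unit_cone V Q T" and v: "v \<in> V" and l: "threshold T Q v < l"
  shows "l \<cdot> Q + v \<in> T"
proof -
  have "\<exists>c. c \<cdot> Q + v \<in> T" using T v by (auto simp: order_unit_cone_def)
  then obtain k where k: "k \<cdot> Q + v \<in> T" "k < l"
    using l cInf_less_iff[OF _ threshold_bdd_below[OF T v], of l] by (auto simp: threshold_def)
  have "(l - k) \<cdot> Q + (k \<cdot> Q + v) \<in> T"
    using k T wedgeD(1) wedgeD(2)[of T "l - k" Q] unfolding order_unit_cone_def by simp
  then show ?thesis by (simp add: scale_left_diff_distrib)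
qed

lemma threshold_lower_bound:
  assumes T: "order_unit_cone V Q T" and v: "v \<in> V" and l: "l \<cdot> Q + v \<notin> T"
  shows "l \<le> threshold T Q v"
  using above_threshold[OF T v, of l] l by force

lemma threshold_bound:
  assumes T: "order_unit_cone V Q T" and v: "v \<in> V" and l: "l \<cdot> Q + v \<in> T"
  shows "threshold T Q v \<le> l"
  unfolding threshold_def using l by (intro cInf_lower threshold_bdd_below[OF T v]) simp

text \<open>
  If \<open>- Q\<close> were of the form \<open>t + c \<cdot> w\<close> then \<open>T\<close> would contain a vector contradicting the choice of the threshold: one
  below it when \<open>c < 0\<close>, and one whose sum with a vector just above it is a negative multiple of \<open>Q\<close> when \<open>c > 0\<close>.
\<close>
lemma order_unit_cone_step:
  assumes T: "order_unit_cone V Q T" and v: "v \<in> V"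
  defines "w \<equiv> threshold T Q v \<cdot> Q + v"
  shows "order_unit_cone V Q {t + c \<cdot> w | t c. t \<in> T}" (is "order_unit_cone V Q ?T")
proof -
  have sV: "subspace V" and cT: "wedge T" and TV: "T \<subseteq> V" and QT: "Q \<in> T"
    and unit: "\<And>v. v \<in> V \<Longrightarrow> \<exists>c. c \<cdot> Q + v \<in> T"
    using T by (auto simp: order_unit_cone_def)
  have wV: "w \<in> V" unfolding w_def using sV QT TV v by (intro subspace_add subspace_scale) auto
  have T0: "0 \<in> T" using wedgeD(2)[OF cT, of 0 Q] QT by simp
  have sub: "T \<subseteq> ?T"
  proof
    fix t assume "t \<in> T"
    then have "t = t + 0 \<cdot> w \<and> t \<in> T" by simp
    then show "t \<in> ?T" by blast
  qed
  have TV': "?T \<subseteq> V" using sV wV TV by (auto intro!: subspace_add subspace_scale)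
  have wT: "wedge ?T"
    unfolding wedge_def
  proof (intro conjI ballI allI impI)
    fix x y assume "x \<in> ?T" "y \<in> ?T"
    then obtain s c t d where "x = s + c \<cdot> w" "s \<in> T" "y = t + d \<cdot> w" "t \<in> T" by blast
    then have "x + y = (s + t) + (c + d) \<cdot> w" "s + t \<in> T"
      using wedgeD(1)[OF cT] by (auto simp: scale_left_distrib algebra_simps)
    then show "x + y \<in> ?T" by blast
  next
    fix c :: real and x assume c: "0 \<le> c" "x \<in> ?T"
    then obtain t d where "x = t + d \<cdot> w" "t \<in> T" by blast
    then have "c \<cdot> x = c \<cdot> t + (c * d) \<cdot> w" "c \<cdot> t \<in> T"
      using wedgeD(2)[OF cT] c by (auto simp: scale_right_distrib)
    then show "c \<cdot> x \<in> ?T" by blast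
  qed
  have nQ: "- Q \<notin> ?T"
  proof
    assume "- Q \<in> ?T"
    then obtain t c where t: "t \<in> T" "- Q = t + c \<cdot> w" by blast
    define a where "a = threshold T Q v"
    consider "c = 0" | "c > 0" | "c < 0" by linarith
    then show False
    proof cases
      case 1
      then show ?thesis using t T by (simp add: order_unit_cone_def)
    next
      case 2
      have "- v \<in> V" using sV v by (rule subspace_neg)
      have "inverse c \<cdot> t \<in> T" using 2 t by (intro wedgeD(2)[OF cT]) auto
      moreover have "inverse c \<cdot> t = (- a - inverse c) \<cdot> Q - v"
      proof -
        have "t = - Q - c \<cdot> w" using t(2) by (simp add: algebra_simps)
        then show ?thesis using 2
          by (simp add: w_def a_def scale_right_diff_distrib scale_left_diff_distrib scale_right_distrib)
      qed
      moreover have "(a + inverse c / 2) \<cdot> Q + v \<in> T"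
        using 2 by (intro above_threshold[OF T v]) (simp add: a_def)
      ultimately have "((- a - inverse c) \<cdot> Q - v) + ((a + inverse c / 2) \<cdot> Q + v) \<in> T"
        using wedgeD(1)[OF cT] by metis
      then have "((- a - inverse c) + (a + inverse c / 2)) \<cdot> Q \<in> T"
        unfolding scale_left_distrib by (simp add: algebra_simps)
      then have "0 \<le> (- a - inverse c) + (a + inverse c / 2)"
        by (rule multiple_of_unit_nonneg[OF T])
      then show ?thesis using 2 by simp
    next
      case 3
      define k where "k = - c"
      have k: "k > 0" using 3 by (simp add: k_def)
      have "inverse k \<cdot> t \<in> T" using k t by (intro wedgeD(2)[OF cT]) auto
      moreover have "inverse k \<cdot> t = (a - inverse k) \<cdot> Q + v"
      proof -
        have "t = - Q + k \<cdot> w" using t(2) by (simp add: algebra_simps k_def)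
        then show ?thesis using k
          by (simp add: w_def a_def scale_right_diff_distrib scale_left_diff_distrib scale_right_distrib)
      qed
      ultimately have "a \<le> a - inverse k"
        using threshold_bound[OF T v, of "a - inverse k"] by (simp add: a_def)
      then show ?thesis using k by simp
    qed
  qed
  have "Q \<in> ?T" using sub QT by (rule subsetD)
  moreover have "\<forall>v\<in>V. \<exists>c. c \<cdot> Q + v \<in> ?T"
    using unit subsetD[OF sub] by meson
  ultimately show ?thesis
    unfolding order_unit_cone_def using sV TV' wT nQ by (intro conjI)
qed

lemma order_unit_cone_chain:
  assumes "order_unit_cone V Q T" and "range e \<subseteq> V"
  shows "order_unit_cone V Q (chain T Q e n)"
proof (induction n)
  case (Suc n)
  show ?case unfolding chain.simps
    by (rule order_unit_cone_step[OF Suc.IH]) (use assms in blast)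
qed (use assms in simp)

lemma chain_mono_Suc: "chain T Q e n \<subseteq> chain T Q e (Suc n)"
proof
  fix t assume "t \<in> chain T Q e n"
  then have "t = t + 0 \<cdot> (threshold (chain T Q e n) Q (e n) \<cdot> Q + e n) \<and> t \<in> chain T Q e n" by simp
  then show "t \<in> chain T Q e (Suc n)" unfolding chain.simps by blast
qed

lemma chain_mono: "m \<le> n \<Longrightarrow> chain T Q e m \<subseteq> chain T Q e n"
  using lift_Suc_mono_le[of "chain T Q e"] chain_mono_Suc by blast

text \<open>
  Both summands are bounded below at \<open>e n\<close> by their share of the least value, and the sum attains the least value; so
  neither can exceed its bound. Inductively both summands stay nonnegative on the chain.
\<close>
lemma forced_on_chain:
  assumes T: "order_unit_cone V Q T" and e: "range e \<subseteq> V"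
    and L1: "linear_on V L1" "\<And>t. t \<in> T \<Longrightarrow> 0 \<le> L1 t"
    and L2: "linear_on V L2" "\<And>t. t \<in> T \<Longrightarrow> 0 \<le> L2 t"
    and Q: "L1 Q + L2 Q = 1"
    and sum: "\<And>n. L1 (e n) + L2 (e n) = - threshold (chain T Q e n) Q (e n)"
  shows "L1 (e n) = - L1 Q * threshold (chain T Q e n) Q (e n)"
proof -
  have QV: "Q \<in> V" and sV: "subspace V" using T by (auto simp: order_unit_cone_def)
  have eV: "e n \<in> V" for n using e by blast
  let ?a = "\<lambda>n. threshold (chain T Q e n) Q (e n)"
  have lower: "- (K Q * ?a n) \<le> K (e n)"
    if K: "linear_on V K" "\<And>t. t \<in> chain T Q e n \<Longrightarrow> 0 \<le> K t" for K n
  proof -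
    note C = order_unit_cone_chain[OF T e, of n]
    have "Q \<in> chain T Q e n" using C by (simp add: order_unit_cone_def)
    then have KQ: "0 \<le> K Q" by (rule K(2))
    have "- (K Q * ?a n) \<le> K (e n) + \<delta>" if "0 < \<delta>" for \<delta>
    proof -
      define \<eta> where "\<eta> = \<delta> / (1 + K Q)"
      have \<eta>: "0 < \<eta>" "K Q * \<eta> \<le> \<delta>" using that KQ by (auto simp: \<eta>_def field_simps)
      have "0 \<le> K ((?a n + \<eta>) \<cdot> Q + e n)"
        using \<eta> by (intro K(2) above_threshold[OF C eV]) simp
      also have "\<dots> = (?a n + \<eta>) * K Q + K (e n)"
        using K(1) QV eV sV subspace_scale by (simp add: linear_on_def)
      finally show ?thesis using \<eta> by (simp add: algebra_simps)
    qed
    then show ?thesis by (rule field_le_epsilon)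
  qed
  have eq: "L1 (e n) = - (L1 Q * ?a n) \<and> L2 (e n) = - (L2 Q * ?a n)"
    if "\<And>t. t \<in> chain T Q e n \<Longrightarrow> 0 \<le> L1 t" "\<And>t. t \<in> chain T Q e n \<Longrightarrow> 0 \<le> L2 t" for n
  proof -
    have "L1 (e n) + L2 (e n) = - (L1 Q * ?a n) + - (L2 Q * ?a n)"
      unfolding sum using Q by (metis minus_add_distrib distrib_right mult_1)
    then show ?thesis
      using lower[OF L1(1), of n] lower[OF L2(1), of n] that by simp
  qed
  have nonneg: "(\<forall>t\<in>chain T Q e n. 0 \<le> L1 t) \<and> (\<forall>t\<in>chain T Q e n. 0 \<le> L2 t)" for n
  proof (induction n)
    case 0
    then show ?case using L1 L2 by simp
  next
    case (Suc n)
    have pin: "K (t + c \<cdot> (?a n \<cdot> Q + e n)) = K t"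
      if "linear_on V K" "K (e n) = - (K Q * ?a n)" "t \<in> chain T Q e n" for K t c
    proof -
      have "t \<in> V" using order_unit_cone_chain[OF T e, of n] that(3) by (auto simp: order_unit_cone_def)
      moreover have "?a n \<cdot> Q \<in> V" "?a n \<cdot> Q + e n \<in> V" "c \<cdot> (?a n \<cdot> Q + e n) \<in> V"
        using QV eV sV by (auto intro!: subspace_scale subspace_add)
      ultimately show ?thesis using that(1,2) QV eV by (simp add: linear_on_def)
    qed
    have e12: "L1 (e n) = - (L1 Q * ?a n)" "L2 (e n) = - (L2 Q * ?a n)" using eq[of n] Suc by simp_all
    show ?case
    proof (intro conjI ballI)
      fix x assume "x \<in> chain T Q e (Suc n)"
      then obtain t c where t: "x = t + c \<cdot> (?a n \<cdot> Q + e n)" "t \<in> chain T Q e n" by auto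
      show "0 \<le> L1 x" "0 \<le> L2 x"
        unfolding t(1) pin[OF L1(1) e12(1) t(2)] pin[OF L2(1) e12(2) t(2)] using Suc t(2) by simp_all
    qed
  qed
  show ?thesis using eq[of n] nonneg[of n] by simp
qed

text \<open>
  Hahn-Banach extension along a countable spanning family, choosing the least possible value at every step. This greedy
  choice makes the functional extreme, without any compactness or Krein-Milman argument. Starting with the
  vector to be separated makes its value at most \<open>- \<epsilon>\<close>.
\<close>
lemma extreme_functional:
  fixes e :: "nat \<Rightarrow> 'a"
  assumes T: "order_unit_cone V Q T" and V: "V = span (range e)"
    and sep: "\<epsilon> \<cdot> Q + e 0 \<notin> T"
  shows "\<exists>L. linear_on V L \<and> (\<forall>t\<in>T. 0 \<le> L t) \<and> L Q = 1 \<and> L (e 0) \<le> - \<epsilon> \<and> extreme_on V T L"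
proof -
  have e: "range e \<subseteq> V" unfolding V by (rule span_superset)
  then have eV: "e n \<in> V" for n by blast
  have sV: "subspace V" and QT: "Q \<in> T" and QV: "Q \<in> V" using T by (auto simp: order_unit_cone_def)
  define N where "N = (\<Union>n. chain T Q e n)"
  have TN: "T \<subseteq> N" unfolding N_def using chain.simps(1)[of T Q e] by blast
  note C = order_unit_cone_chain[OF T e]
  have Cw: "wedge (chain T Q e n)" for n using C[of n] by (simp add: order_unit_cone_def)
  have cN: "wedge N"
    unfolding wedge_def
  proof (intro conjI ballI allI impI)
    fix u v assume "u \<in> N" "v \<in> N"
    then obtain m n where mn: "u \<in> chain T Q e m" "v \<in> chain T Q e n" by (auto simp: N_def)
    then have "u \<in> chain T Q e (max m n)" "v \<in> chain T Q e (max m n)"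
      using subsetD[OF chain_mono[of m "max m n"]] subsetD[OF chain_mono[of n "max m n"]] by simp_all
    then have "u + v \<in> chain T Q e (max m n)" by (rule wedgeD(1)[OF Cw])
    then show "u + v \<in> N" by (auto simp: N_def)
  next
    fix c :: real and u assume "0 \<le> c" "u \<in> N"
    then show "c \<cdot> u \<in> N" unfolding N_def using wedgeD(2)[OF Cw] by blast
  qed
  have Npos: "0 \<le> c" if "c \<cdot> Q \<in> N" for c
    using that multiple_of_unit_nonneg[OF C] by (auto simp: N_def)
  have N0: "0 \<in> N" using wedgeD(2)[OF cN, of 0 Q] QT TN by auto
  define val where "val v a \<longleftrightarrow> v - a \<cdot> Q \<in> N \<and> a \<cdot> Q - v \<in> N" for v a
  have val_add: "val (u + v) (a + b)" if "val u a" "val v b" for u v a b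
  proof -
    have "(u - a \<cdot> Q) + (v - b \<cdot> Q) \<in> N" "(a \<cdot> Q - u) + (b \<cdot> Q - v) \<in> N"
      using that wedgeD(1)[OF cN] by (auto simp: val_def)
    then show ?thesis by (simp add: val_def scale_left_distrib algebra_simps)
  qed
  have val_scale: "val (c \<cdot> v) (c * a)" if "val v a" for c v a
  proof (cases "0 \<le> c")
    case True
    then have "c \<cdot> (v - a \<cdot> Q) \<in> N" "c \<cdot> (a \<cdot> Q - v) \<in> N"
      using that wedgeD(2)[OF cN] by (auto simp: val_def)
    then show ?thesis by (simp add: val_def scale_right_diff_distrib)
  next
    case False
    then have "(- c) \<cdot> (v - a \<cdot> Q) \<in> N" "(- c) \<cdot> (a \<cdot> Q - v) \<in> N"
      using that wedgeD(2)[OF cN, of "- c"] by (auto simp: val_def)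
    then show ?thesis by (simp add: val_def scale_right_diff_distrib)
  qed
  have val_le: "a \<le> b" if "val v a" "val v b" for v a b
  proof -
    have "(v - a \<cdot> Q) + (b \<cdot> Q - v) \<in> N" by (rule wedgeD(1)[OF cN]) (use that in \<open>auto simp: val_def\<close>)
    then have "(b - a) \<cdot> Q \<in> N" by (simp add: scale_left_diff_distrib)
    then show ?thesis using Npos by fastforce
  qed
  have val_e: "val (e n) (- threshold (chain T Q e n) Q (e n))" for n
  proof -
    define w where "w = threshold (chain T Q e n) Q (e n) \<cdot> Q + e n"
    have z: "0 \<in> chain T Q e n"
    proof -
      have "wedge (chain T Q e n)" "Q \<in> chain T Q e n" using C[of n] by (auto simp: order_unit_cone_def)
      from wedgeD(2)[OF this(1) _ this(2), of 0] show ?thesis by simp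
    qed
    have "0 + c \<cdot> w \<in> chain T Q e (Suc n)" for c
      unfolding chain.simps w_def[symmetric] using z by blast
    then have "c \<cdot> w \<in> N" for c unfolding N_def by (metis UN_I UNIV_I add_0)
    from this[of 1] this[of "-1"] have "w \<in> N" "- w \<in> N" by simp_all
    moreover have "e n - (- threshold (chain T Q e n) Q (e n)) \<cdot> Q = w"
      by (simp add: w_def add.commute)
    moreover have "(- threshold (chain T Q e n) Q (e n)) \<cdot> Q - e n = - w"
      by (simp add: w_def)
    ultimately show ?thesis by (simp only: val_def)
  qed
  have val_ex: "\<exists>a. val v a" if "v \<in> V" for v
    using that unfolding V
  proof (induction rule: span_induct_alt)
    case base
    have "val 0 0" using N0 by (simp add: val_def)
    then show ?case by blast
  next
    case (step c x y)
    then show ?case using val_add val_scale val_e by blast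
  qed
  define L where "L v = (THE a. val v a)" for v
  have L: "L v = a" if "val v a" for v a
    unfolding L_def using that val_le by (intro the_equality antisym) auto
  have valL: "val v (L v)" if "v \<in> V" for v using val_ex[OF that] L by blast
  have lin: "linear_on V L"
    unfolding linear_on_def using L val_add val_scale valL by blast
  have nonneg: "0 \<le> L t" if "t \<in> T" for t
  proof -
    have "t \<in> V" using T that by (auto simp: order_unit_cone_def)
    then have "L t \<cdot> Q - t + t \<in> N"
      using valL that TN wedgeD(1)[OF cN] unfolding val_def by blast
    then show ?thesis using Npos by simp
  qed
  have Le: "L (e n) = - threshold (chain T Q e n) Q (e n)" for n by (rule L[OF val_e])
  have "val Q 1" using N0 by (simp add: val_def)
  then have LQ: "L Q = 1" by (rule L)
  have "\<epsilon> \<le> threshold T Q (e 0)" by (rule threshold_lower_bound[OF T eV sep])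
  then have "L (e 0) \<le> - \<epsilon>" using Le[of 0] by simp
  have "L1 v = L1 Q * L v"
    if L1: "linear_on V L1" "\<And>t. t \<in> T \<Longrightarrow> 0 \<le> L1 t" and L2: "linear_on V L2" "\<And>t. t \<in> T \<Longrightarrow> 0 \<le> L2 t"
      and sum: "\<And>v. v \<in> V \<Longrightarrow> L1 v + L2 v = L v" and v: "v \<in> V" for L1 L2 v
  proof -
    have on_e: "L1 (e n) = L1 Q * L (e n)" for n
      using forced_on_chain[OF T e L1 L2, of n] sum[OF QV] sum[OF eV] LQ Le by simp
    have on_0: "L1 0 = 0 \<and> L 0 = 0"
    proof -
      have "0 \<in> V" using sV subspace_0 by blast
      then have "L1 (0 \<cdot> 0) = 0 * L1 0" "L (0 \<cdot> 0) = 0 * L 0" using L1(1) lin unfolding linear_on_def by blast+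
      then show ?thesis by simp
    qed
    from v[unfolded V] have "v \<in> V \<and> L1 v = L1 Q * L v"
    proof (induction rule: span_induct_alt)
      case base
      then show ?case using on_0 subspace_0[OF sV] by simp
    next
      case (step c x y)
      then have "x \<in> V" "y \<in> V" "c \<cdot> x \<in> V" "L1 x = L1 Q * L x" "L1 y = L1 Q * L y"
        using eV sV subspace_scale on_e by auto
      then show ?case
        using L1(1) lin sV subspace_add by (simp add: linear_on_def algebra_simps)
    qed
    then show ?thesis by blast
  qed
  then have "extreme_on V T L" unfolding extreme_on_def by blast
  moreover have "\<forall>t\<in>T. 0 \<le> L t" using nonneg by blast
  ultimately show ?thesis using lin LQ \<open>L (e 0) \<le> - \<epsilon>\<close> by (intro exI[of _ L] conjI)
qed

end

section \<open>Specializing the X-variables\<close>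

lemma Cst_simps: "Cst 0 = 0" "Cst 1 = 1" "Cst (a + b) = Cst a + Cst b" "Cst (a * b) = Cst a * Cst b"
    "Cst (- a) = - Cst a" "Cst (a - b) = Cst a - Cst b"
  by (simp_all add: Cst_def single_add mult_single single_uminus single_diff)

lemma Cst_power: "Cst (a ^ n) = Cst a ^ n"
  by (induction n) (simp_all add: Cst_simps)

lemma Cst_times_single: "Cst c * Poly_Mapping.single m a = Poly_Mapping.single m (c * a)"
  by (simp add: Cst_def mult_single)

lemma rpoly_expansion: "p = (\<Sum>m\<in>Poly_Mapping.keys p. Poly_Mapping.single m (Poly_Mapping.lookup p m))"
  by (rule poly_mapping_eqI) (simp add: lookup_sum lookup_single when_def in_keys_iff)

lemma single_eq_Var_prod:
  fixes m :: "'v::finite \<Rightarrow>\<^sub>0 nat"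
  shows "Poly_Mapping.single m (1 :: real) = (\<Prod>v\<in>UNIV. Var v ^ Poly_Mapping.lookup m v)"
proof -
  have pow: "Var v ^ k = Poly_Mapping.single (Poly_Mapping.single v k) (1 :: real)" for v :: 'v and k
    by (induction k) (simp_all add: Var_def mult_single flip: single_add)
  have prod: "(\<Prod>v\<in>A. Poly_Mapping.single (g v) (1 :: real)) = Poly_Mapping.single (\<Sum>v\<in>A. g v) 1"
    for A and g :: "'v \<Rightarrow> 'v \<Rightarrow>\<^sub>0 nat"
    by (induction A rule: infinite_finite_induct) (simp_all add: mult_single)
  have "(\<Sum>v\<in>UNIV. Poly_Mapping.single v (Poly_Mapping.lookup m v)) = m"
    by (rule poly_mapping_eqI) (simp add: lookup_sum lookup_single when_def)
  then show ?thesis by (simp add: pow prod)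
qed

lemma peval_superset:
  assumes "finite A" "Poly_Mapping.keys p \<subseteq> A"
  shows "peval x p = (\<Sum>m\<in>A. Poly_Mapping.lookup p m * (\<Prod>v\<in>UNIV. x v ^ Poly_Mapping.lookup m v))"
  unfolding peval_def using assms
  by (intro sum.mono_neutral_left) (auto simp: in_keys_iff)

lemma peval_add: "peval x (p + q) = peval x p + peval x q"
proof -
  let ?A = "Poly_Mapping.keys p \<union> Poly_Mapping.keys q"
  have "peval x (p + q) = (\<Sum>m\<in>?A. Poly_Mapping.lookup (p + q) m * (\<Prod>v\<in>UNIV. x v ^ Poly_Mapping.lookup m v))"
    by (intro peval_superset keys_add) simp
  then show ?thesis
    by (simp add: lookup_add distrib_right sum.distrib peval_superset[of ?A])
qed

lemma peval_0: "peval x 0 = 0"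
  by (simp add: peval_def)

lemma peval_sum: "peval x (\<Sum>i\<in>A. g i) = (\<Sum>i\<in>A. peval x (g i))"
  by (induction A rule: infinite_finite_induct) (simp_all add: peval_add peval_0)

lemma peval_single: "peval x (Poly_Mapping.single m c) = c * (\<Prod>v\<in>UNIV. x v ^ Poly_Mapping.lookup m v)"
  by (subst peval_superset[of "{m}"]) auto

lemma peval_mult: "peval x (p * q) = peval x p * peval x q"
proof -
  have single: "peval x (Poly_Mapping.single m a * Poly_Mapping.single n b)
      = peval x (Poly_Mapping.single m a) * peval x (Poly_Mapping.single n b)" for m n a b
    by (simp add: mult_single peval_single lookup_add power_add prod.distrib)
  let ?s = "\<lambda>p m. Poly_Mapping.single m (Poly_Mapping.lookup p m)"
  have "p * q = (\<Sum>m\<in>Poly_Mapping.keys p. ?s p m) * (\<Sum>n\<in>Poly_Mapping.keys q. ?s q n)"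
    by (simp flip: rpoly_expansion)
  then have "peval x (p * q) = (\<Sum>m\<in>Poly_Mapping.keys p. peval x (?s p m)) * (\<Sum>n\<in>Poly_Mapping.keys q. peval x (?s q n))"
    by (simp only: sum_product peval_sum single)
  also have "\<dots> = peval x (\<Sum>m\<in>Poly_Mapping.keys p. ?s p m) * peval x (\<Sum>n\<in>Poly_Mapping.keys q. ?s q n)"
    by (simp only: peval_sum)
  finally show ?thesis by (simp flip: rpoly_expansion)
qed

lemma peval_Cst: "peval x (Cst c) = c"
  by (simp add: Cst_def peval_single)

lemma peval_Var: "peval x (Var v) = x v"
proof -
  have "peval x (Var v) = (\<Prod>w\<in>UNIV. if w = v then x w else 1)"
    unfolding Var_def peval_single mult_1 by (rule prod.cong) (auto simp: lookup_single)
  then show ?thesis by simp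
qed

lemma peval_power: "peval x (p ^ n) = peval x p ^ n"
  using peval_Cst[of x 1] by (induction n) (simp_all add: peval_mult Cst_simps)

text \<open>
  The restriction of \<open>p\<close> to the line through \<open>r\<close> parallel to the \<open>Y\<close>-axis, as a univariate polynomial in \<open>Y\<close>.
\<close>
definition specialize :: "'v \<Rightarrow> ('v \<Rightarrow> real) \<Rightarrow> 'v::finite rpoly \<Rightarrow> real poly" where
  "specialize Y r p = (\<Sum>m\<in>Poly_Mapping.keys p. monom
     (Poly_Mapping.lookup p m * (\<Prod>v\<in>UNIV - {Y}. r v ^ Poly_Mapping.lookup m v)) (Poly_Mapping.lookup m Y))"

lemma poly_specialize: "poly (specialize Y r p) y = peval (r(Y := y)) p"
proof -
  have "(\<Prod>v\<in>UNIV. (r(Y := y)) v ^ Poly_Mapping.lookup m v)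
      = (\<Prod>v\<in>UNIV - {Y}. r v ^ Poly_Mapping.lookup m v) * y ^ Poly_Mapping.lookup m Y" for m
    by (subst prod.remove[of _ Y]) (auto intro!: prod.cong)
  then show ?thesis
    by (simp add: specialize_def peval_def poly_sum poly_monom mult.assoc)
qed

lemma real_poly_ext: "(\<And>y. poly p y = poly q y) \<Longrightarrow> p = (q :: real poly)"
  by (simp add: poly_eq_poly_eq_iff[symmetric] fun_eq_iff)

lemma specialize_hom:
  "specialize Y r (p + q) = specialize Y r p + specialize Y r q"
  "specialize Y r (p * q) = specialize Y r p * specialize Y r q"
  "specialize Y r (Cst c) = [:c:]"
  by (rule real_poly_ext, simp add: poly_specialize peval_add peval_mult peval_Cst)+

lemma specialize_Cst_times: "specialize Y r (Cst c * p) = smult c (specialize Y r p)"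
  by (simp add: specialize_hom)

lemma specialize_sum: "specialize Y r (\<Sum>i\<in>A. g i) = (\<Sum>i\<in>A. specialize Y r (g i))"
  by (rule real_poly_ext) (simp add: poly_specialize peval_sum poly_sum)

definition deg_le :: "'v \<Rightarrow> nat \<Rightarrow> 'v rpoly set" where
  "deg_le Y k = {p. \<forall>m\<in>Poly_Mapping.keys p. Poly_Mapping.lookup m Y \<le> k}"

lemma deg_le_mono: "p \<in> deg_le Y k \<Longrightarrow> k \<le> l \<Longrightarrow> p \<in> deg_le Y l"
  by (force simp: deg_le_def)

lemma deg_le_add: "p \<in> deg_le Y k \<Longrightarrow> q \<in> deg_le Y k \<Longrightarrow> p + q \<in> deg_le Y k"
  using keys_add[of p q] by (fastforce simp: deg_le_def)

lemma deg_le_mult: "p \<in> deg_le Y k \<Longrightarrow> q \<in> deg_le Y l \<Longrightarrow> p * q \<in> deg_le Y (k + l)"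
  using keys_mult[of p q] by (fastforce simp: deg_le_def lookup_add intro: add_mono)

lemma deg_le_Cst: "Cst c \<in> deg_le Y k"
  by (auto simp: deg_le_def Cst_def)

lemma deg_le_0: "0 \<in> deg_le Y k"
  by (simp add: deg_le_def)

lemma deg_le_scale: "p \<in> deg_le Y k \<Longrightarrow> Cst c * p \<in> deg_le Y k"
  using deg_le_mult[OF deg_le_Cst[of c Y 0], of p k] by simp

lemma deg_le_minus: "p \<in> deg_le Y k \<Longrightarrow> - p \<in> deg_le Y k"
  using deg_le_scale[of p Y k "-1"] by (simp add: Cst_simps)

lemma deg_le_diff: "p \<in> deg_le Y k \<Longrightarrow> q \<in> deg_le Y k \<Longrightarrow> p - q \<in> deg_le Y k"
  using deg_le_add[of p Y k "- q"] deg_le_minus[of q] by simp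

lemma deg_le_sum: "(\<And>i. i \<in> A \<Longrightarrow> g i \<in> deg_le Y k) \<Longrightarrow> (\<Sum>i\<in>A. g i) \<in> deg_le Y k"
  by (induction A rule: infinite_finite_induct) (simp_all add: deg_le_0 deg_le_add)

lemma deg_le_power: "p \<in> deg_le Y k \<Longrightarrow> p ^ n \<in> deg_le Y (n * k)"
  using deg_le_Cst[of 1 Y 0] by (induction n) (simp_all add: Cst_simps deg_le_mult)

lemma deg_le_Var: "Var v \<in> deg_le Y (if v = Y then 1 else 0)"
  by (simp add: deg_le_def Var_def lookup_single)

lemma deg_le_Var_power: "Var Y ^ j \<in> deg_le Y j"
  using deg_le_power[OF deg_le_Var[of Y Y], of j] by simp

lemma ex_deg_le: "\<exists>k. p \<in> deg_le Y k"
proof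
  show "p \<in> deg_le Y (\<Sum>m\<in>Poly_Mapping.keys p. Poly_Mapping.lookup m Y)"
    by (auto simp: deg_le_def intro!: member_le_sum)
qed

lemma degree_specialize_le: "p \<in> deg_le Y k \<Longrightarrow> degree (specialize Y r p) \<le> k"
  unfolding specialize_def deg_le_def
  by (intro degree_sum_le order_trans[OF degree_monom_le]) auto

text \<open>
  The univariate polynomial \<open>g\<close> read as a polynomial in the indeterminate \<open>Y\<close>.
\<close>
definition inject_Y :: "'v \<Rightarrow> real poly \<Rightarrow> 'v rpoly" where
  "inject_Y Y g = (\<Sum>j\<le>degree g. Cst (coeff g j) * Var Y ^ j)"

lemma specialize_inject_Y: "specialize Y r (inject_Y Y g) = g"
proof (rule real_poly_ext)
  fix y
  have "poly g y = (\<Sum>j\<le>degree g. coeff g j * y ^ j)" by (rule poly_altdef)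
  then show "poly (specialize Y r (inject_Y Y g)) y = poly g y"
    by (simp add: poly_specialize inject_Y_def peval_sum peval_mult peval_power peval_Cst peval_Var)
qed

lemma inject_Y_deg_le: "inject_Y Y g \<in> deg_le Y (degree g)"
  unfolding inject_Y_def
  by (intro deg_le_sum deg_le_scale) (auto intro: deg_le_mono[OF deg_le_Var_power])

section \<open>The order unit of an archimedean quadratic module\<close>

definition quadratic_module :: "'v rpoly set \<Rightarrow> bool" where
  "quadratic_module M \<longleftrightarrow> 1 \<in> M \<and> (\<forall>p\<in>M. \<forall>q\<in>M. p + q \<in> M) \<and> (\<forall>g. \<forall>p\<in>M. g\<^sup>2 * p \<in> M)"

lemma quadratic_moduleD:
  assumes "quadratic_module M"
  shows "p \<in> M \<Longrightarrow> q \<in> M \<Longrightarrow> p + q \<in> M" "p \<in> M \<Longrightarrow> g\<^sup>2 * p \<in> M" "g\<^sup>2 \<in> M"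
    "p \<in> M \<Longrightarrow> 0 \<le> c \<Longrightarrow> Cst c * p \<in> M" "0 \<le> c \<Longrightarrow> Cst c \<in> M" "0 \<in> M"
    "(\<And>i. i \<in> A \<Longrightarrow> h i \<in> M) \<Longrightarrow> (\<Sum>i\<in>A. h i) \<in> M"
proof -
  show add: "p \<in> M \<Longrightarrow> q \<in> M \<Longrightarrow> p + q \<in> M" for p q using assms by (simp add: quadratic_module_def)
  show times: "p \<in> M \<Longrightarrow> g\<^sup>2 * p \<in> M" for p g using assms by (simp add: quadratic_module_def)
  have one: "1 \<in> M" using assms by (simp add: quadratic_module_def)
  show sq: "g\<^sup>2 \<in> M" for g using times[OF one, of g] by simp
  have c: "Cst c = (Cst (sqrt c))\<^sup>2" if "0 \<le> c" for c
    using that by (simp flip: Cst_power)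
  show "Cst c * p \<in> M" if "p \<in> M" "0 \<le> c" for p c
    unfolding c[OF that(2)] by (rule times[OF that(1)])
  show "Cst c \<in> M" if "0 \<le> c" for c
    unfolding c[OF that] by (rule sq)
  show zero: "0 \<in> M" using sq[of 0] by simp
  show "(\<And>i. i \<in> A \<Longrightarrow> h i \<in> M) \<Longrightarrow> (\<Sum>i\<in>A. h i) \<in> M"
    by (induction A rule: infinite_finite_induct) (simp_all add: zero add)
qed

text \<open>
  From \<open>a b - p\<^sup>2 q\<^sup>2 = a (b - q\<^sup>2) + q\<^sup>2 (a - p\<^sup>2)\<close>: boundedness modulo a quadratic module passes to products,
  although the module itself need not be closed under multiplication.
\<close>
lemma bounded_mult:
  assumes M: "quadratic_module M" and "0 \<le> a" "Cst a - p\<^sup>2 \<in> M" "Cst b - q\<^sup>2 \<in> M"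
  shows "Cst (a * b) - (p * q)\<^sup>2 \<in> M"
proof -
  have "Cst a * (Cst b - q\<^sup>2) + q\<^sup>2 * (Cst a - p\<^sup>2) \<in> M"
    by (intro quadratic_moduleD(1,2,4)[OF M] assms)
  moreover have "Cst a * (Cst b - q\<^sup>2) + q\<^sup>2 * (Cst a - p\<^sup>2) = Cst (a * b) - (p * q)\<^sup>2"
    by (simp add: Cst_simps algebra_simps power_mult_distrib)
  ultimately show ?thesis by simp
qed

lemma bounded_one: "quadratic_module M \<Longrightarrow> Cst 1 - 1\<^sup>2 \<in> M"
  using quadratic_moduleD(6) by (simp add: Cst_simps)

lemma bounded_power:
  assumes M: "quadratic_module M" and "0 \<le> a" "Cst a - p\<^sup>2 \<in> M"
  shows "Cst (a ^ n) - (p ^ n)\<^sup>2 \<in> M"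
proof (induction n)
  case 0
  then show ?case using bounded_one[OF M] by simp
next
  case (Suc n)
  then show ?case using bounded_mult[OF M \<open>0 \<le> a\<close> assms(3), of "a ^ n" "p ^ n"] by simp
qed

lemma bounded_prod:
  assumes M: "quadratic_module M"
    and p: "\<And>i. i \<in> I \<Longrightarrow> 0 \<le> a i" "\<And>i. i \<in> I \<Longrightarrow> Cst (a i) - (p i)\<^sup>2 \<in> M"
  shows "Cst (\<Prod>i\<in>I. a i) - (\<Prod>i\<in>I. p i)\<^sup>2 \<in> M"
  using p
proof (induction I rule: infinite_finite_induct)
  case (insert i I)
  then have "Cst (a i * (\<Prod>i\<in>I. a i)) - (p i * (\<Prod>i\<in>I. p i))\<^sup>2 \<in> M" by (intro bounded_mult[OF M]) auto
  then show ?case using insert(1,2) by simp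
qed (use bounded_one[OF M] in simp_all)

lemma bounded_Var:
  assumes M: "quadratic_module M" and arch: "Cst N - (\<Sum>i\<in>UNIV - {Y}. (Var i)\<^sup>2) \<in> M" and "i \<noteq> Y"
  shows "Cst N - (Var (i :: 'v::finite))\<^sup>2 \<in> M"
proof -
  have "(Cst N - (\<Sum>i\<in>UNIV - {Y}. (Var i)\<^sup>2)) + (\<Sum>j\<in>UNIV - {Y} - {i}. (Var j)\<^sup>2) \<in> M"
    by (intro quadratic_moduleD(1,3,7)[OF M] arch)
  moreover have "(\<Sum>i\<in>UNIV - {Y}. (Var i)\<^sup>2) = (Var i)\<^sup>2 + (\<Sum>j\<in>UNIV - {Y} - {i}. (Var j)\<^sup>2)"
    using \<open>i \<noteq> Y\<close> by (intro sum.remove) auto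
  ultimately show ?thesis by simp
qed

definition Y_squares :: "'v \<Rightarrow> nat \<Rightarrow> 'v rpoly" where
  "Y_squares Y h = (\<Sum>j\<le>h. (Var Y ^ j)\<^sup>2)"

lemma Y_squares_in: "quadratic_module M \<Longrightarrow> Y_squares Y h \<in> M"
  unfolding Y_squares_def by (intro quadratic_moduleD(7)) (auto intro: quadratic_moduleD(3))

lemma Y_squares_deg_le: "Y_squares Y h \<in> deg_le Y (2 * h)"
  unfolding Y_squares_def
  by (intro deg_le_sum) (auto intro!: deg_le_mono[OF deg_le_power[OF deg_le_Var_power]])

interpretation real_space "\<lambda>c p. Cst c * p"
  using vector_space_rpoly by (simp add: real_space_def)

lemma subspace_deg_le: "subspace (deg_le Y k)"
  by (simp add: subspace_def deg_le_0 deg_le_add deg_le_scale)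

text \<open>
  Writing \<open>j = a + b\<close> with \<open>a, b \<le> h\<close>, the mixed term \<open>2 s x Y\<^sup>a Y\<^sup>b\<close> is completed to the square
  \<open>(x Y\<^sup>a + s Y\<^sup>b)\<^sup>2\<close>, and the squares \<open>x\<^sup>2 Y\<^sup>2\<^sup>a\<close> and \<open>Y\<^sup>2\<^sup>b\<close> are absorbed by a multiple of \<open>Q\<close> since \<open>x\<close> is bounded.
\<close>
lemma Y_squares_dominates_monomial:
  fixes Y :: 'v
  assumes M: "quadratic_module M" and x: "0 \<le> c" "Cst c - x\<^sup>2 \<in> M" and "j \<le> 2 * h" and s: "s = 1 \<or> s = -1"
  shows "\<exists>C. Cst C * Y_squares Y h + Cst s * (x * Var Y ^ j) \<in> M"
proof -
  obtain a b where ab: "j = a + b" "a \<le> h" "b \<le> h"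
    using that[of "min j h" "j - min j h"] \<open>j \<le> 2 * h\<close> by auto
  define C where "C = max c 1"
  let ?a = "Var Y ^ a" and ?b = "Var Y ^ b" and ?Q = "Y_squares Y h"
  note D = quadratic_moduleD[OF M]
  have Qa: "?Q - (Var Y ^ i)\<^sup>2 \<in> M" if "i \<le> h" for i
  proof -
    have "?Q = (Var Y ^ i)\<^sup>2 + (\<Sum>j\<in>{..h} - {i}. (Var Y ^ j)\<^sup>2)"
      unfolding Y_squares_def using that by (intro sum.remove) auto
    then have "?Q - (Var Y ^ i)\<^sup>2 = (\<Sum>j\<in>{..h} - {i}. (Var Y ^ j)\<^sup>2)" by simp
    also have "\<dots> \<in> M" by (intro D(3,7))
    finally show ?thesis .
  qed
  have "Cst c - x\<^sup>2 + Cst (C - c) \<in> M" using x(2) by (intro D(1,5)) (simp_all add: C_def)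
  then have xC: "Cst C - x\<^sup>2 \<in> M" by (simp add: Cst_simps)
  have "(x * ?a + Cst s * ?b)\<^sup>2 + ?a\<^sup>2 * (Cst C - x\<^sup>2) + ?b\<^sup>2 * Cst (C - 1)
      + Cst C * (?Q - ?a\<^sup>2) + Cst C * (?Q - ?b\<^sup>2) \<in> M" (is "?l \<in> M")
    by (intro D(1-5) xC Qa ab) (use x(1) in \<open>auto simp: C_def\<close>)
  moreover have "?l = Cst (2 * C) * ?Q + Cst (2 * s) * (x * Var Y ^ j)"
  proof -
    have "Cst s * Cst s = (1 :: 'v rpoly)" using s by (auto simp: Cst_simps simp flip: Cst_simps(4))
    then have sb: "(Cst s * ?b)\<^sup>2 = ?b\<^sup>2" by (simp add: power_mult_distrib power2_eq_square[of "Cst s"])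
    moreover have "Cst (2 * s) = (2 * Cst s :: 'v rpoly)" "Cst (2 * C) = (2 * Cst C :: 'v rpoly)"
      using Cst_simps(3)[of s s] Cst_simps(3)[of C C] by simp_all
    ultimately show ?thesis
      unfolding power2_sum sb
      by (simp add: ab(1) power_add Cst_simps(2,6) algebra_simps power_mult_distrib)
  qed
  ultimately have "Cst (2 * C) * ?Q + Cst (2 * s) * (x * Var Y ^ j) \<in> M" by simp
  then have "Cst (1 / 2) * (Cst (2 * C) * ?Q + Cst (2 * s) * (x * Var Y ^ j)) \<in> M"
    by (rule D(4)) simp
  moreover have "Cst (1 / 2) * (Cst (2 * C) * ?Q + Cst (2 * s) * (x * Var Y ^ j)) = Cst C * ?Q + Cst s * (x * Var Y ^ j)"
    by (simp add: distrib_left flip: mult.assoc Cst_simps(4))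
  ultimately show ?thesis by auto
qed

lemma Y_squares_order_unit:
  fixes Y :: "'v::finite"
  assumes M: "quadratic_module M" and "0 \<le> N" and arch: "Cst N - (\<Sum>i\<in>UNIV - {Y}. (Var i)\<^sup>2) \<in> M"
    and p: "p \<in> deg_le Y (2 * h)"
  shows "\<exists>C. Cst C * Y_squares Y h + p \<in> M"
proof -
  note D = quadratic_moduleD[OF M]
  have mono: "\<exists>C. Cst C * Y_squares Y h + Poly_Mapping.single m a \<in> M"
    if m: "Poly_Mapping.lookup m Y \<le> 2 * h" for m and a :: real
  proof -
    let ?x = "\<Prod>i\<in>UNIV - {Y}. Var i ^ Poly_Mapping.lookup m i :: 'v rpoly"
    have bd: "Cst (\<Prod>i\<in>UNIV - {Y}. N ^ Poly_Mapping.lookup m i) - ?x\<^sup>2 \<in> M"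
      using \<open>0 \<le> N\<close> by (intro bounded_prod[OF M] bounded_power[OF M] bounded_Var[OF M arch]) auto
    have nn: "0 \<le> (\<Prod>i\<in>UNIV - {Y}. N ^ Poly_Mapping.lookup m i)"
      using \<open>0 \<le> N\<close> by (intro prod_nonneg) simp
    define s :: real where "s = (if a \<ge> 0 then 1 else -1)"
    have s: "s = 1 \<or> s = -1" by (simp add: s_def)
    obtain C where "Cst C * Y_squares Y h + Cst s * (?x * Var Y ^ Poly_Mapping.lookup m Y) \<in> M"
      using Y_squares_dominates_monomial[OF M nn bd m s] by blast
    then have mul: "Cst \<bar>a\<bar> * (Cst C * Y_squares Y h + Cst s * (?x * Var Y ^ Poly_Mapping.lookup m Y)) \<in> M"
      by (rule D(4)) simp
    have eq: "Cst \<bar>a\<bar> * (Cst s * (?x * Var Y ^ Poly_Mapping.lookup m Y)) = Poly_Mapping.single m a"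
    proof -
      have "?x * Var Y ^ Poly_Mapping.lookup m Y = Poly_Mapping.single m 1"
        unfolding single_eq_Var_prod by (subst (2) prod.remove[of _ Y]) (auto simp: mult.commute)
      moreover have "\<bar>a\<bar> * s = a" by (simp add: s_def)
      ultimately show ?thesis by (simp add: Cst_times_single)
    qed
    have "Cst (\<bar>a\<bar> * C) * Y_squares Y h + Poly_Mapping.single m a \<in> M"
      using mul unfolding distrib_left eq by (simp only: Cst_simps(4) mult.assoc)
    then show ?thesis by blast
  qed
  have "\<exists>C. Cst C * Y_squares Y h + (\<Sum>m\<in>A. Poly_Mapping.single m (Poly_Mapping.lookup p m)) \<in> M"
    if "finite A" "A \<subseteq> Poly_Mapping.keys p" for A
    using that
  proof (induction A rule: finite_induct)
    case empty
    have "Cst 0 * Y_squares Y h + 0 \<in> M" using D(6) by (simp add: Cst_simps)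
    then show ?case unfolding sum.empty by (rule exI)
  next
    case (insert m A)
    then obtain C where "Cst C * Y_squares Y h + (\<Sum>m\<in>A. Poly_Mapping.single m (Poly_Mapping.lookup p m)) \<in> M"
      by auto
    moreover have "Poly_Mapping.lookup m Y \<le> 2 * h" using insert(4) p by (auto simp: deg_le_def)
    then obtain C' where "Cst C' * Y_squares Y h + Poly_Mapping.single m (Poly_Mapping.lookup p m) \<in> M"
      using mono by blast
    ultimately have "(Cst C' * Y_squares Y h + Poly_Mapping.single m (Poly_Mapping.lookup p m))
        + (Cst C * Y_squares Y h + (\<Sum>m\<in>A. Poly_Mapping.single m (Poly_Mapping.lookup p m))) \<in> M"
      by (rule_tac D(1))
    then have "Cst (C' + C) * Y_squares Y h + (\<Sum>m\<in>insert m A. Poly_Mapping.single m (Poly_Mapping.lookup p m)) \<in> M"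
      using insert(1,2) by (simp add: Cst_simps(3) algebra_simps)
    then show ?case by blast
  qed
  from this[of "Poly_Mapping.keys p"] show ?thesis by (simp flip: rpoly_expansion)
qed

text \<open>
  If \<open>- Q\<close> were in \<open>M\<close>, every polynomial of \<open>Y\<close>-degree at most \<open>2 h\<close> would be in \<open>M\<close> by the order unit property, in
  particular \<open>f + \<epsilon> Q\<close>.
\<close>
lemma order_unit_cone_truncation:
  fixes Y :: "'v::finite"
  assumes M: "quadratic_module M" and "0 \<le> N" and arch: "Cst N - (\<Sum>i\<in>UNIV - {Y}. (Var i)\<^sup>2) \<in> M"
    and f: "f \<in> deg_le Y (2 * h)" "f + Cst \<epsilon> * Y_squares Y h \<notin> M"
  shows "order_unit_cone (deg_le Y (2 * h)) (Y_squares Y h) (M \<inter> deg_le Y (2 * h))"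
proof -
  note D = quadratic_moduleD[OF M]
  let ?Q = "Y_squares Y h"
  have QM: "?Q \<in> M" by (rule Y_squares_in[OF M])
  have unit: "\<exists>C. Cst C * ?Q + p \<in> M" if "p \<in> deg_le Y (2 * h)" for p
    using Y_squares_order_unit[OF M \<open>0 \<le> N\<close> arch that] .
  have "- ?Q \<notin> M"
  proof
    assume neg: "- ?Q \<in> M"
    obtain C where C: "Cst C * ?Q + f \<in> M" using unit f by blast
    have "Cst (\<epsilon> - C) * ?Q \<in> M"
    proof (cases "C \<le> \<epsilon>")
      case True
      then show ?thesis by (intro D(4) QM) simp
    next
      case False
      then have "Cst (C - \<epsilon>) * (- ?Q) \<in> M" by (intro D(4) neg) simp
      then show ?thesis by (simp add: Cst_simps algebra_simps)
    qed
    then have "(Cst C * ?Q + f) + Cst (\<epsilon> - C) * ?Q \<in> M" by (rule_tac D(1)[OF C])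
    then have "f + Cst \<epsilon> * ?Q \<in> M" by (simp add: Cst_simps algebra_simps)
    then show False using f by simp
  qed
  moreover have "wedge (M \<inter> deg_le Y (2 * h))"
    unfolding wedge_def by (auto intro: D(1,4) deg_le_add deg_le_scale)
  moreover have "\<exists>c. Cst c * ?Q + v \<in> M \<inter> deg_le Y (2 * h)" if "v \<in> deg_le Y (2 * h)" for v
    using unit[OF that] deg_le_add[OF deg_le_scale[OF Y_squares_deg_le] that] by blast
  ultimately show ?thesis
    unfolding order_unit_cone_def by (simp add: subspace_deg_le QM Y_squares_deg_le)
qed

text \<open>
  The quotients \<open>a (j + 1) / a j\<close> increase, so if already the first one exceeded \<open>N\<close>, the sequence would outgrow
  \<open>N ^ j\<close>.
\<close>
lemma log_convex_growth:
  fixes a :: "nat \<Rightarrow> real"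
  assumes nonneg: "\<And>j. 0 \<le> a j" and convex: "\<And>j. (a (Suc j))\<^sup>2 \<le> a j * a (Suc (Suc j))"
    and growth: "\<And>j. a j \<le> C * N ^ j" and "0 < N"
  shows "a 1 \<le> N * a 0"
proof (cases "a 0 = 0")
  case True
  then show ?thesis using convex[of 0] by simp
next
  case False
  then have a0: "0 < a 0" using nonneg[of 0] by simp
  show ?thesis
  proof (rule ccontr)
    assume not_le: "\<not> a 1 \<le> N * a 0"
    define \<rho> where "\<rho> = a 1 / a 0"
    have \<rho>: "N < \<rho>" using not_le a0 by (simp add: \<rho>_def field_simps)
    then have \<rho>0: "0 < \<rho>" using \<open>0 < N\<close> by simp
    have step: "0 < a j \<and> \<rho> * a j \<le> a (Suc j)" for j
    proof (induction j)
      case 0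
      then show ?case using a0 by (simp add: \<rho>_def)
    next
      case (Suc j)
      have pos: "0 < a (Suc j)" using Suc \<rho>0 by (smt (verit) mult_pos_pos)
      have "a j * (\<rho> * a (Suc j)) = (\<rho> * a j) * a (Suc j)" by simp
      also have "\<dots> \<le> a (Suc j) * a (Suc j)" using Suc pos by (intro mult_right_mono) auto
      also have "\<dots> \<le> a j * a (Suc (Suc j))" using convex[of j] by (simp add: power2_eq_square)
      finally show ?case using Suc pos by simp
    qed
    have lower: "\<rho> ^ j * a 0 \<le> a j" for j
    proof (induction j)
      case (Suc j)
      have "\<rho> ^ Suc j * a 0 = \<rho> * (\<rho> ^ j * a 0)" by simp
      also have "\<dots> \<le> \<rho> * a j" using Suc \<rho>0 by (intro mult_left_mono) auto
      also have "\<dots> \<le> a (Suc j)" using step by blast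
      finally show ?case .
    qed simp
    obtain n where n: "C / a 0 < (\<rho> / N) ^ n"
      using real_arch_pow[of "\<rho> / N" "C / a 0"] \<rho> \<open>0 < N\<close> by auto
    then have "C * N ^ n < \<rho> ^ n * a 0"
      using a0 \<open>0 < N\<close> by (simp add: field_simps power_divide)
    then show False using lower[of n] growth[of n] by simp
  qed
qed

section \<open>Extreme functionals live on a single fibre\<close>

text \<open>
  The functional with \<open>Y ^ j \<mapsto> \<mu> j\<close>.
\<close>
definition moment_functional :: "(nat \<Rightarrow> real) \<Rightarrow> real poly \<Rightarrow> real" where
  "moment_functional \<mu> h = (\<Sum>j\<le>degree h. coeff h j * \<mu> j)"

lemma moment_functional_eq:
  assumes "degree h \<le> n"
  shows "moment_functional \<mu> h = (\<Sum>j\<le>n. coeff h j * \<mu> j)"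
  unfolding moment_functional_def using assms
  by (intro sum.mono_neutral_left) (auto simp: coeff_eq_0)

lemma poly_functional_moment_functional: "poly_functional (moment_functional \<mu>)"
proof
  fix p q :: "real poly" and c :: real
  let ?n = "max (degree p) (degree q)"
  show "moment_functional \<mu> (p + q) = moment_functional \<mu> p + moment_functional \<mu> q"
    using moment_functional_eq[of "p + q" ?n \<mu>] moment_functional_eq[of p ?n \<mu>]
      moment_functional_eq[of q ?n \<mu>] degree_add_le_max[of p q]
    by (simp add: distrib_right sum.distrib)
  show "moment_functional \<mu> (smult c p) = c * moment_functional \<mu> p"
    using moment_functional_eq[of "smult c p" "degree p" \<mu>]
    by (simp add: moment_functional_def sum_distrib_left mult.assoc)
qed

lemma moment_functional_monom: "moment_functional \<mu> (monom a j) = a * \<mu> j"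
proof -
  have "moment_functional \<mu> (monom a j) = (\<Sum>i\<le>j. if i = j then a * \<mu> j else 0)"
    unfolding moment_functional_eq[OF degree_monom_le] by (rule sum.cong) auto
  then show ?thesis by simp
qed

lemma deg_le_eq_span:
  fixes Y :: "'v::finite"
  assumes f: "f \<in> deg_le Y k"
  shows "\<exists>e :: nat \<Rightarrow> 'v rpoly. e 0 = f \<and> deg_le Y k = span (range e)"
proof -
  define I where "I = {m :: 'v \<Rightarrow>\<^sub>0 nat. Poly_Mapping.lookup m Y \<le> k}"
  have "countable I"
  proof (rule countable_image_inj_on)
    show "inj_on Poly_Mapping.lookup I" by (rule inj_onI) (simp only: poly_mapping_eq_iff)
    show "countable (Poly_Mapping.lookup ` I)" by (rule countableI_type)
  qed
  moreover have "0 \<in> I" by (simp add: I_def)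
  then have "I \<noteq> {}" by blast
  ultimately have ran: "range (from_nat_into I) = I" by (intro range_from_nat_into)
  define e where "e = case_nat f (\<lambda>n. Poly_Mapping.single (from_nat_into I n) (1 :: real))"
  have "range e \<subseteq> deg_le Y k"
  proof
    fix p assume "p \<in> range e"
    then obtain n where n: "p = e n" by blast
    show "p \<in> deg_le Y k"
    proof (cases n)
      case (Suc l)
      have "from_nat_into I l \<in> I" using ran by blast
      then show ?thesis using n Suc by (simp add: e_def deg_le_def I_def)
    qed (use n f in \<open>simp add: e_def\<close>)
  qed
  then have "span (range e) \<subseteq> deg_le Y k" by (rule span_minimal[OF _ subspace_deg_le])
  moreover have "p \<in> span (range e)" if p: "p \<in> deg_le Y k" for p
  proof -
    have "Poly_Mapping.single m a \<in> span (range e)" if "m \<in> Poly_Mapping.keys p" for m a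
    proof -
      have "m \<in> I" using that p by (simp add: I_def deg_le_def)
      then obtain n where "m = from_nat_into I n" using ran by (metis imageE)
      then have "Poly_Mapping.single m 1 = e (Suc n)" by (simp add: e_def)
      then have "Poly_Mapping.single m 1 \<in> span (range e)" by (simp add: span_base)
      then have "Cst a * Poly_Mapping.single m 1 \<in> span (range e)" by (rule span_scale)
      then show ?thesis by (simp add: Cst_times_single)
    qed
    then have "(\<Sum>m\<in>Poly_Mapping.keys p. Poly_Mapping.single m (Poly_Mapping.lookup p m)) \<in> span (range e)"
      by (rule span_sum)
    then show ?thesis by (simp flip: rpoly_expansion)
  qed
  ultimately show ?thesis by (intro exI[of _ e]) (auto simp: e_def)
qed

text \<open>
  The situation after separation: a functional on the polynomials of \<open>Y\<close>-degree at most \<open>2 h\<close> that is nonnegative on a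
  quadratic module in which the \<open>X\<close>-variables are bounded.
\<close>
locale truncated_functional =
  fixes M :: "'v::finite rpoly set" and Y :: 'v and N :: real and h :: nat and L :: "'v rpoly \<Rightarrow> real"
  assumes M: "quadratic_module M" and N: "0 < N"
    and arch: "Cst N - (\<Sum>i\<in>UNIV - {Y}. (Var i)\<^sup>2) \<in> M"
    and linear: "linear_on (deg_le Y (2 * h)) L"
    and nonneg: "\<And>t. t \<in> M \<Longrightarrow> t \<in> deg_le Y (2 * h) \<Longrightarrow> 0 \<le> L t"
    and normalized: "L (Y_squares Y h) = 1"
begin

lemmas M_closed = quadratic_moduleD[OF M]

lemma L_add: "u \<in> deg_le Y (2 * h) \<Longrightarrow> v \<in> deg_le Y (2 * h) \<Longrightarrow> L (u + v) = L u + L v"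
  using linear by (simp add: linear_on_def)

lemma L_scale: "v \<in> deg_le Y (2 * h) \<Longrightarrow> L (Cst c * v) = c * L v"
  using linear by (simp add: linear_on_def)

lemma L_diff:
  assumes "u \<in> deg_le Y (2 * h)" "v \<in> deg_le Y (2 * h)"
  shows "L (u - v) = L u - L v"
  using L_add[OF assms(1) deg_le_scale[OF assms(2), of "-1"]] L_scale[OF assms(2), of "-1"]
  by (simp add: Cst_simps)

lemma times_X_deg_le: "x \<in> deg_le Y 0 \<Longrightarrow> v \<in> deg_le Y (2 * h) \<Longrightarrow> x * v \<in> deg_le Y (2 * h)"
  using deg_le_mult[of x Y 0 v "2 * h"] by simp

lemma L_sum: "(\<And>i. i \<in> A \<Longrightarrow> g i \<in> deg_le Y (2 * h)) \<Longrightarrow> L (\<Sum>i\<in>A. g i) = (\<Sum>i\<in>A. L (g i))"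
proof (induction A rule: infinite_finite_induct)
  case (insert i A)
  then show ?case using L_add[of "g i" "\<Sum>i\<in>A. g i"] deg_le_sum[of A g] by simp
qed (use L_scale[OF deg_le_0, of 0] in \<open>simp_all add: Cst_simps\<close>)

lemma L_Cauchy_Schwarz:
  assumes u: "u \<in> deg_le Y 0" and w: "w \<in> deg_le Y 0" and t: "t \<in> M" "t \<in> deg_le Y (2 * h)"
  shows "(L (u * w * t))\<^sup>2 \<le> L (u\<^sup>2 * t) * L (w\<^sup>2 * t)"
proof (rule quadratic_form_nonneg)
  have uw: "u * w \<in> deg_le Y 0" "u\<^sup>2 \<in> deg_le Y 0" "w\<^sup>2 \<in> deg_le Y 0"
    using deg_le_mult[OF u w] deg_le_power[OF u, of 2] deg_le_power[OF w, of 2] by simp_all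
  note mem = times_X_deg_le[OF uw(1) t(2)] times_X_deg_le[OF uw(2) t(2)] times_X_deg_le[OF uw(3) t(2)]
  show "0 \<le> L (u\<^sup>2 * t)" by (intro nonneg M_closed(2) t mem)
  fix c
  have "(Cst c * u + w)\<^sup>2 * t = Cst (c\<^sup>2) * (u\<^sup>2 * t) + Cst (2 * c) * (u * w * t) + w\<^sup>2 * t"
  proof -
    have "Cst (2 * c) = (2 * Cst c :: 'v rpoly)" using Cst_simps(3)[of c c] by simp
    then show ?thesis by (simp add: power2_sum power_mult_distrib Cst_power algebra_simps)
  qed
  moreover have "Cst c * u + w \<in> deg_le Y 0" by (intro deg_le_add deg_le_scale u w)
  then have "(Cst c * u + w)\<^sup>2 \<in> deg_le Y 0" using deg_le_power[of _ Y 0 2] by simp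
  then have "(Cst c * u + w)\<^sup>2 * t \<in> deg_le Y (2 * h)" using t(2) by (rule times_X_deg_le)
  then have "0 \<le> L ((Cst c * u + w)\<^sup>2 * t)" by (intro nonneg M_closed(2) t)
  ultimately show "0 \<le> c\<^sup>2 * L (u\<^sup>2 * t) + 2 * c * L (u * w * t) + L (w\<^sup>2 * t)"
    using mem by (simp add: L_add L_scale deg_le_add deg_le_scale)
qed

lemma Var_power_deg_le: "i \<noteq> Y \<Longrightarrow> Var i ^ j \<in> deg_le Y 0"
  using deg_le_power[OF deg_le_Var[of i Y], of j] by simp

text \<open>
  The inequality \<open>0 \<le> L ((N - X\<^sup>2) t)\<close> is not immediate, since \<open>(N - X\<^sup>2) t\<close> need not lie in \<open>M\<close>. Instead
  the moments \<open>L (X\<^sup>2\<^sup>j t)\<close> are log-convex by Cauchy-Schwarz, and their growth is at most that of \<open>N ^ j\<close> because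
  \<open>t\<close> is dominated by a multiple of \<open>Q\<close>, for which \<open>(N ^ j - X\<^sup>2\<^sup>j) Q\<close> does lie in \<open>M\<close>.
\<close>
lemma Var_square_bound:
  assumes i: "i \<noteq> Y" and t: "t \<in> M" "t \<in> deg_le Y (2 * h)"
  shows "L ((Var i)\<^sup>2 * t) \<le> N * L t"
proof -
  define a where "a j = L ((Var i ^ j)\<^sup>2 * t)" for j
  have X: "(Var i ^ j)\<^sup>2 \<in> deg_le Y 0" for j
    by (rule deg_le_power[OF Var_power_deg_le[OF i], where n = 2, unfolded mult_0_right])
  obtain C where C: "Cst C * Y_squares Y h + - t \<in> M"
    using Y_squares_order_unit[OF M less_imp_le[OF N] arch deg_le_minus[OF t(2)]] by blast
  have mem: "Cst C * Y_squares Y h + - t \<in> deg_le Y (2 * h)"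
    by (intro deg_le_add deg_le_scale deg_le_minus Y_squares_deg_le t)
  have "0 \<le> L (Cst C * Y_squares Y h + - t)" by (rule nonneg[OF C mem])
  also have "\<dots> = C - L t"
    using L_diff[OF deg_le_scale[OF Y_squares_deg_le] t(2), of C] L_scale[OF Y_squares_deg_le, of C]
    by (simp add: normalized)
  finally have C0: "0 \<le> C" using nonneg[OF t] by simp
  have growth: "a j \<le> C * N ^ j" for j
  proof -
    let ?X = "(Var i ^ j)\<^sup>2"
    have XQ: "?X * Y_squares Y h \<in> deg_le Y (2 * h)" by (rule times_X_deg_le[OF X Y_squares_deg_le])
    have "0 \<le> L (?X * (Cst C * Y_squares Y h + - t))"
      by (intro nonneg M_closed(2) C times_X_deg_le[OF X mem])
    also have "?X * (Cst C * Y_squares Y h + - t) = Cst C * (?X * Y_squares Y h) - ?X * t"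
      by (simp add: algebra_simps)
    also have "L \<dots> = C * L (?X * Y_squares Y h) - a j"
      using L_diff[OF deg_le_scale[OF XQ] times_X_deg_le[OF X t(2)], of C] L_scale[OF XQ, of C]
      by (simp add: a_def)
    finally have 1: "a j \<le> C * L (?X * Y_squares Y h)" by simp
    have bd: "Cst (N ^ j) - ?X \<in> M"
      by (rule bounded_power[OF M less_imp_le[OF N] bounded_Var[OF M arch i]])
    have "(\<Sum>k\<le>h. (Var Y ^ k)\<^sup>2 * (Cst (N ^ j) - ?X)) \<in> M" by (intro M_closed(7) M_closed(2) bd)
    also have "(\<Sum>k\<le>h. (Var Y ^ k)\<^sup>2 * (Cst (N ^ j) - ?X)) = Cst (N ^ j) * Y_squares Y h - ?X * Y_squares Y h"
      unfolding Y_squares_def sum_distrib_right[symmetric] by (simp add: algebra_simps)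
    finally have "0 \<le> L (Cst (N ^ j) * Y_squares Y h - ?X * Y_squares Y h)"
      by (rule nonneg) (intro deg_le_diff deg_le_scale Y_squares_deg_le XQ)
    then have "L (?X * Y_squares Y h) \<le> N ^ j"
      using L_diff[OF deg_le_scale[OF Y_squares_deg_le] XQ, of "N ^ j"] L_scale[OF Y_squares_deg_le, of "N ^ j"]
      by (simp add: normalized)
    then have "C * L (?X * Y_squares Y h) \<le> C * N ^ j" using C0 by (rule mult_left_mono)
    then show ?thesis using 1 by simp
  qed
  have "a 1 \<le> N * a 0"
  proof (rule log_convex_growth[OF _ _ growth N])
    show "0 \<le> a j" for j
      unfolding a_def by (intro nonneg M_closed(2) t times_X_deg_le[OF X])
    show "(a (Suc j))\<^sup>2 \<le> a j * a (Suc (Suc j))" for j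
    proof -
      have "Var i ^ j * Var i ^ Suc (Suc j) = (Var i ^ Suc j)\<^sup>2"
        by (simp add: power2_eq_square mult_ac)
      then show ?thesis
        using L_Cauchy_Schwarz[OF Var_power_deg_le[OF i] Var_power_deg_le[OF i] t, of j "Suc (Suc j)"]
        unfolding a_def by simp
    qed
  qed
  then show ?thesis by (simp add: a_def)
qed

text \<open>
  By Cauchy-Schwarz \<open>(L (X t))\<^sup>2 \<le> L (X\<^sup>2 t) L t \<le> N (L t)\<^sup>2\<close>.
\<close>
lemma linear_factor_nonneg:
  assumes i: "i \<noteq> Y" and t: "t \<in> M" "t \<in> deg_le Y (2 * h)" and s: "s = 1 \<or> s = -1"
  shows "0 \<le> L ((Cst (sqrt N) + Cst s * Var i) * t)"
proof -
  have X: "Var i \<in> deg_le Y 0" using Var_power_deg_le[OF i, of 1] by simp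
  have one: "1 \<in> deg_le Y 0" using deg_le_Cst[of 1 Y 0] by (simp add: Cst_simps)
  have Lt: "0 \<le> L t" by (rule nonneg[OF t])
  have "(L (Var i * t))\<^sup>2 \<le> L ((Var i)\<^sup>2 * t) * L t"
    using L_Cauchy_Schwarz[OF X one t] by simp
  also have "\<dots> \<le> (N * L t) * L t"
    by (rule mult_right_mono[OF Var_square_bound[OF i t] Lt])
  also have "\<dots> = (sqrt N * L t)\<^sup>2" using N by (simp add: power2_eq_square)
  finally have "\<bar>L (Var i * t)\<bar> \<le> \<bar>sqrt N * L t\<bar>" by (simp add: abs_le_square_iff)
  then have "\<bar>L (Var i * t)\<bar> \<le> sqrt N * L t" using Lt N by simp
  moreover have "L ((Cst (sqrt N) + Cst s * Var i) * t) = sqrt N * L t + s * L (Var i * t)"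
  proof -
    have Xt: "Var i * t \<in> deg_le Y (2 * h)" by (rule times_X_deg_le[OF X t(2)])
    have "(Cst (sqrt N) + Cst s * Var i) * t = Cst (sqrt N) * t + Cst s * (Var i * t)"
      by (simp add: algebra_simps)
    then show ?thesis
      using L_add[OF deg_le_scale[OF t(2)] deg_le_scale[OF Xt]] L_scale[OF t(2)] L_scale[OF Xt] by simp
  qed
  ultimately show ?thesis using s by auto
qed

text \<open>
  The functional is the sum of \<open>v \<mapsto> L ((c + X) v) / (2 c)\<close> and \<open>v \<mapsto> L ((c - X) v) / (2 c)\<close> with \<open>c\<^sup>2 = N\<close>, both of
  them positive; extremality makes the first one a multiple of \<open>L\<close>.
\<close>
lemma multiplicative_if_extreme:
  assumes extreme: "extreme_on (deg_le Y (2 * h)) (M \<inter> deg_le Y (2 * h)) L"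
    and i: "i \<noteq> Y"
  shows "\<exists>r. \<forall>v\<in>deg_le Y (2 * h). L (Var i * v) = r * L v"
proof -
  define c where "c = sqrt N"
  have c: "0 < c" using N by (simp add: c_def)
  have X: "Var i \<in> deg_le Y 0" using Var_power_deg_le[OF i, of 1] by simp
  define K where "K s v = L ((Cst c + Cst s * Var i) * v) / (2 * c)" for s v
  have K: "K s v = (c * L v + s * L (Var i * v)) / (2 * c)" if v: "v \<in> deg_le Y (2 * h)" for s v
  proof -
    have Xv: "Var i * v \<in> deg_le Y (2 * h)" by (rule times_X_deg_le[OF X v])
    have "(Cst c + Cst s * Var i) * v = Cst c * v + Cst s * (Var i * v)"
      by (simp add: algebra_simps)
    then show ?thesis
      using L_add[OF deg_le_scale[OF v] deg_le_scale[OF Xv], of c s] L_scale[OF v, of c] L_scale[OF Xv, of s]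
      by (simp add: K_def)
  qed
  have lin: "linear_on (deg_le Y (2 * h)) (K s)" for s
    unfolding linear_on_def
  proof (intro conjI ballI allI)
    fix u v :: "'v rpoly" and a :: real
    assume u: "u \<in> deg_le Y (2 * h)" and v: "v \<in> deg_le Y (2 * h)"
    have "(Cst c + Cst s * Var i) * (u + v) = (Cst c + Cst s * Var i) * u + (Cst c + Cst s * Var i) * v"
      by (rule distrib_left)
    moreover have "(Cst c + Cst s * Var i) \<in> deg_le Y 0" by (intro deg_le_add deg_le_scale deg_le_Cst X)
    ultimately show "K s (u + v) = K s u + K s v"
      using L_add[OF times_X_deg_le[OF _ u] times_X_deg_le[OF _ v]] by (simp add: K_def add_divide_distrib)
  next
    fix a :: real and v :: "'v rpoly"
    assume v: "v \<in> deg_le Y (2 * h)"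
    have eq: "(Cst c + Cst s * Var i) * (Cst a * v) = Cst a * ((Cst c + Cst s * Var i) * v)"
      by (rule mult.left_commute)
    have "(Cst c + Cst s * Var i) \<in> deg_le Y 0" by (intro deg_le_add deg_le_scale deg_le_Cst X)
    then have "L (Cst a * ((Cst c + Cst s * Var i) * v)) = a * L ((Cst c + Cst s * Var i) * v)"
      by (intro L_scale times_X_deg_le v)
    then show "K s (Cst a * v) = a * K s v" unfolding K_def eq by simp
  qed
  have pos: "0 \<le> K s t" if "t \<in> M \<inter> deg_le Y (2 * h)" "s = 1 \<or> s = -1" for s t
    unfolding K_def c_def using linear_factor_nonneg[OF i _ _ that(2)] that(1) c by (simp add: c_def)
  have sum: "K 1 v + K (-1) v = L v" if "v \<in> deg_le Y (2 * h)" for v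
    using c by (simp add: K[OF that] flip: add_divide_distrib)
  have "\<exists>\<alpha>. \<forall>v\<in>deg_le Y (2 * h). K 1 v = \<alpha> * L v"
    using extreme[unfolded extreme_on_def, rule_format, of "K 1" "K (-1)"] lin pos sum by simp
  then obtain \<alpha> where \<alpha>: "\<And>v. v \<in> deg_le Y (2 * h) \<Longrightarrow> K 1 v = \<alpha> * L v" by blast
  have "L (Var i * v) = (2 * c * \<alpha> - c) * L v" if "v \<in> deg_le Y (2 * h)" for v
    using K[OF that, of 1] \<alpha>[OF that] c by (simp add: field_simps)
  then show ?thesis by blast
qed

lemma factors_through_fibre:
  assumes r: "\<And>i v. i \<noteq> Y \<Longrightarrow> v \<in> deg_le Y (2 * h) \<Longrightarrow> L (Var i * v) = r i * L v"
    and p: "p \<in> deg_le Y (2 * h)"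
  shows "L p = moment_functional (\<lambda>j. L (Var Y ^ j)) (specialize Y r p)"
proof -
  have pow: "L (Var i ^ n * v) = r i ^ n * L v" if i: "i \<noteq> Y" and v: "v \<in> deg_le Y (2 * h)" for i n v
  proof (induction n)
    case (Suc n)
    have "Var i ^ n * v \<in> deg_le Y (2 * h)" by (rule times_X_deg_le[OF Var_power_deg_le[OF i] v])
    then show ?case using r[OF i] Suc by (simp add: mult.assoc)
  qed simp
  have prod: "L ((\<Prod>i\<in>I. Var i ^ n i) * v) = (\<Prod>i\<in>I. r i ^ n i) * L v"
    if "I \<subseteq> UNIV - {Y}" and v: "v \<in> deg_le Y (2 * h)" for I n v
    using finite_subset[OF that(1) finite] that(1)
  proof (induction I rule: finite_induct)
    case (insert i I)
    have "(\<Prod>i\<in>I. Var i ^ n i) \<in> deg_le Y 0" using insert(2,4)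
    proof (induction I rule: infinite_finite_induct)
      case (insert j J)
      then have "Var j ^ n j * (\<Prod>i\<in>J. Var i ^ n i) \<in> deg_le Y (0 + 0)"
        by (intro deg_le_mult Var_power_deg_le) auto
      then show ?case using insert by simp
    qed (use deg_le_Cst[of 1 Y 0] in \<open>simp_all add: Cst_simps\<close>)
    then have "(\<Prod>i\<in>I. Var i ^ n i) * v \<in> deg_le Y (2 * h)" using v by (rule times_X_deg_le)
    moreover have "i \<noteq> Y" using insert by auto
    ultimately show ?case using pow[of i] insert by (simp add: mult.assoc)
  qed simp
  have single: "L (Poly_Mapping.single m a) = a * (\<Prod>i\<in>UNIV - {Y}. r i ^ Poly_Mapping.lookup m i) * L (Var Y ^ Poly_Mapping.lookup m Y)"
    if m: "Poly_Mapping.lookup m Y \<le> 2 * h" for m a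
  proof -
    have Yj: "Var Y ^ Poly_Mapping.lookup m Y \<in> deg_le Y (2 * h)"
      by (rule deg_le_mono[OF deg_le_Var_power m])
    have "Poly_Mapping.single m (1 :: real)
        = (\<Prod>i\<in>UNIV - {Y}. Var i ^ Poly_Mapping.lookup m i) * Var Y ^ Poly_Mapping.lookup m Y"
      unfolding single_eq_Var_prod by (subst prod.remove[of _ Y]) (auto simp: mult.commute)
    then have "L (Poly_Mapping.single m 1)
        = (\<Prod>i\<in>UNIV - {Y}. r i ^ Poly_Mapping.lookup m i) * L (Var Y ^ Poly_Mapping.lookup m Y)"
      using prod[OF subset_refl Yj] by simp
    moreover have "Poly_Mapping.single m (1 :: real) \<in> deg_le Y (2 * h)" using m by (simp add: deg_le_def)
    then have "L (Cst a * Poly_Mapping.single m 1) = a * L (Poly_Mapping.single m 1)" by (rule L_scale)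
    ultimately show ?thesis by (simp add: Cst_times_single)
  qed
  interpret mf: poly_functional "moment_functional (\<lambda>j. L (Var Y ^ j))"
    by (rule poly_functional_moment_functional)
  have keys: "Poly_Mapping.lookup m Y \<le> 2 * h" if "m \<in> Poly_Mapping.keys p" for m
    using p that by (simp add: deg_le_def)
  have "L p = L (\<Sum>m\<in>Poly_Mapping.keys p. Poly_Mapping.single m (Poly_Mapping.lookup p m))"
    by (simp flip: rpoly_expansion)
  also have "\<dots> = (\<Sum>m\<in>Poly_Mapping.keys p. L (Poly_Mapping.single m (Poly_Mapping.lookup p m)))"
    by (rule L_sum) (use keys in \<open>simp add: deg_le_def\<close>)
  also have "\<dots> = moment_functional (\<lambda>j. L (Var Y ^ j)) (specialize Y r p)"
    unfolding specialize_def mf.sum moment_functional_monom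
    by (rule sum.cong[OF refl]) (rule single[OF keys])
  finally show ?thesis .
qed

end

lemma fibre_functional:
  fixes Y :: "'v::finite"
  assumes M: "quadratic_module M" and N: "0 < N" and arch: "Cst N - (\<Sum>i\<in>UNIV - {Y}. (Var i)\<^sup>2) \<in> M"
    and f: "f \<in> deg_le Y (2 * h)" "f + Cst \<epsilon> * Y_squares Y h \<notin> M" and "0 < \<epsilon>"
  shows "\<exists>r \<Lambda>. poly_functional \<Lambda> \<and> \<Lambda> (specialize Y r f) < 0 \<and>
    (\<forall>p\<in>M \<inter> deg_le Y (2 * h). 0 \<le> \<Lambda> (specialize Y r p))"
proof -
  obtain e :: "nat \<Rightarrow> 'v rpoly" where e: "e 0 = f" "deg_le Y (2 * h) = span (range e)"
    using deg_le_eq_span[OF f(1)] by blast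
  have sep: "Cst \<epsilon> * Y_squares Y h + e 0 \<notin> M \<inter> deg_le Y (2 * h)"
    using f(2) by (simp add: e add.commute)
  obtain L where L: "linear_on (deg_le Y (2 * h)) L" "\<forall>t\<in>M \<inter> deg_le Y (2 * h). 0 \<le> L t"
    "L (Y_squares Y h) = 1" "L (e 0) \<le> - \<epsilon>"
    and extreme: "extreme_on (deg_le Y (2 * h)) (M \<inter> deg_le Y (2 * h)) L"
    using extreme_functional[OF order_unit_cone_truncation[OF M less_imp_le[OF N] arch f] e(2) sep] by blast
    interpret truncated_functional M Y N h L
      by unfold_locales (use M N arch L in auto)
    have "\<exists>r. \<forall>i. i \<noteq> Y \<longrightarrow> (\<forall>v\<in>deg_le Y (2 * h). L (Var i * v) = r i * L v)"
      using multiplicative_if_extreme[OF extreme] by metis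
    then obtain r where r: "\<And>i v. i \<noteq> Y \<Longrightarrow> v \<in> deg_le Y (2 * h) \<Longrightarrow> L (Var i * v) = r i * L v" by blast
    let ?\<Lambda> = "moment_functional (\<lambda>j. L (Var Y ^ j))"
    have eq: "?\<Lambda> (specialize Y r p) = L p" if "p \<in> deg_le Y (2 * h)" for p
      using factors_through_fibre[OF r that] by simp
    have "?\<Lambda> (specialize Y r f) < 0" using eq[OF f(1)] L(4) \<open>0 < \<epsilon>\<close> by (simp add: e)
    moreover have "\<forall>p\<in>M \<inter> deg_le Y (2 * h). 0 \<le> ?\<Lambda> (specialize Y r p)" using eq L(2) by simp
    ultimately show ?thesis using poly_functional_moment_functional by blast
qed



section \<open>The sequential closure\<close>

lemma sosI: "(\<Sum>i<k. (g i)\<^sup>2) \<in> sos" for k :: nat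
  by (auto simp: sos_def)

lemma sos_0: "0 \<in> sos"
  using sosI[of "\<lambda>_. 0" 0] by simp

lemma sos_add_square:
  assumes "p \<in> sos"
  shows "p + q\<^sup>2 \<in> sos"
proof -
  obtain k :: nat and g where "p = (\<Sum>i<k. (g i)\<^sup>2)" using assms by (auto simp: sos_def)
  then have "p + q\<^sup>2 = (\<Sum>i<Suc k. ((g(k := q)) i)\<^sup>2)" by simp
  then show ?thesis by (simp only: sosI)
qed

lemma sos_square: "q\<^sup>2 \<in> sos"
  using sos_add_square[OF sos_0, of q] by simp

lemma sos_add:
  assumes "p \<in> sos" "q \<in> sos"
  shows "p + q \<in> sos"
proof -
  obtain k :: nat and g where q: "q = (\<Sum>i<k. (g i)\<^sup>2)" using assms by (auto simp: sos_def)
  have "p + (\<Sum>i<n. (g i)\<^sup>2) \<in> sos" for n :: nat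
  proof (induction n)
    case (Suc n)
    then show ?case using sos_add_square[OF Suc, of "g n"] by (simp add: add.assoc)
  qed (use assms in simp)
  then show ?thesis by (simp add: q)
qed

lemma sos_times_square:
  assumes "p \<in> sos"
  shows "q\<^sup>2 * p \<in> sos"
proof -
  obtain k :: nat and g where "p = (\<Sum>i<k. (g i)\<^sup>2)" using assms by (auto simp: sos_def)
  then have "q\<^sup>2 * p = (\<Sum>i<k. (q * g i)\<^sup>2)" by (simp add: sum_distrib_left power_mult_distrib)
  then show ?thesis by (simp only: sosI)
qed

lemma QM_I: "(\<And>i. i \<in> {0..s} \<Longrightarrow> \<sigma> i \<in> sos) \<Longrightarrow> \<sigma> 0 + (\<Sum>i=1..s. \<sigma> i * f i) \<in> QM s f"
  by (auto simp: QM_def)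

lemma quadratic_module_QM: "quadratic_module (QM s f)"
  unfolding quadratic_module_def
proof (intro conjI ballI allI)
  have "(if (0::nat) = 0 then 1 else 0) + (\<Sum>i=1..s. (if i = 0 then 1 else 0) * f i) \<in> QM s f"
    by (rule QM_I) (use sos_square[of 1] sos_0 in auto)
  then show "1 \<in> QM s f" by simp
next
  fix p q assume "p \<in> QM s f" "q \<in> QM s f"
  then obtain \<sigma> \<tau> where p: "p = \<sigma> 0 + (\<Sum>i=1..s. \<sigma> i * f i)" "\<forall>i\<in>{0..s}. \<sigma> i \<in> sos"
    and q: "q = \<tau> 0 + (\<Sum>i=1..s. \<tau> i * f i)" "\<forall>i\<in>{0..s}. \<tau> i \<in> sos" by (auto simp: QM_def)
  have "p + q = (\<sigma> 0 + \<tau> 0) + (\<Sum>i=1..s. (\<sigma> i + \<tau> i) * f i)"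
    by (simp add: p q distrib_right sum.distrib)
  also have "\<dots> \<in> QM s f" by (rule QM_I) (use p q sos_add in blast)
  finally show "p + q \<in> QM s f" .
next
  fix g p assume "p \<in> QM s f"
  then obtain \<sigma> where p: "p = \<sigma> 0 + (\<Sum>i=1..s. \<sigma> i * f i)" "\<forall>i\<in>{0..s}. \<sigma> i \<in> sos"
    by (auto simp: QM_def)
  have "g\<^sup>2 * p = g\<^sup>2 * \<sigma> 0 + (\<Sum>i=1..s. (g\<^sup>2 * \<sigma> i) * f i)"
    by (simp add: p distrib_left sum_distrib_left mult.assoc)
  also have "\<dots> \<in> QM s f" by (rule QM_I) (use p sos_times_square in blast)
  finally show "g\<^sup>2 * p \<in> QM s f" .
qed

lemma generator_in_QM:
  assumes "i \<in> {1..s}"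
  shows "f i \<in> QM s f"
proof -
  have "(if (0::nat) = i then 1 else 0) + (\<Sum>j=1..s. (if j = i then 1 else 0) * f j) \<in> QM s f"
    by (rule QM_I) (use sos_square[of 1] sos_0 in auto)
  moreover have "(\<Sum>j=1..s. (if j = i then 1 else 0) * f j) = (\<Sum>j=1..s. if j = i then f j else 0)"
    by (rule sum.cong) auto
  ultimately show ?thesis using assms by simp
qed

lemma fibre_eq: "fibre s f Y r = {y. \<forall>i\<in>{1..s}. 0 \<le> poly (specialize Y r (f i)) y}"
  by (simp add: fibre_def poly_specialize)

lemma nonneg_on_QM:
  fixes f :: "nat \<Rightarrow> 'v::finite rpoly"
  assumes "poly_functional L" and squares: "\<And>g. 0 \<le> L (g * g)"
    and gens: "\<And>i g. i \<in> {1..s} \<Longrightarrow> 0 \<le> L (g * g * specialize Y r (f i))"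
    and m: "m \<in> QM s f"
  shows "0 \<le> L (specialize Y r m)"
proof -
  interpret poly_functional L by fact
  have weighted: "0 \<le> L (specialize Y r (\<sigma> * p))"
    if "\<sigma> \<in> sos" "\<And>g. 0 \<le> L (g * g * specialize Y r p)" for \<sigma> p
  proof -
    obtain k :: nat and g where \<sigma>: "\<sigma> = (\<Sum>i<k. (g i)\<^sup>2)" using \<open>\<sigma> \<in> sos\<close> by (auto simp: sos_def)
    have "L (specialize Y r (\<sigma> * p)) = (\<Sum>i<k. L (specialize Y r (g i) * specialize Y r (g i) * specialize Y r p))"
      by (simp add: \<sigma> sum_distrib_right specialize_sum specialize_hom power2_eq_square sum)
    then show ?thesis using that(2) by (simp add: sum_nonneg)
  qed
  obtain \<sigma> where m: "m = \<sigma> 0 + (\<Sum>i=1..s. \<sigma> i * f i)" "\<forall>i\<in>{0..s}. \<sigma> i \<in> sos"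
    using m by (auto simp: QM_def)
  have one: "specialize Y r 1 = 1"
    using specialize_hom(3)[of Y r 1] by (simp add: Cst_simps one_pCons)
  have "0 \<le> L (specialize Y r (\<sigma> 0 * 1))"
    using m(2) squares by (intro weighted) (simp_all add: one)
  moreover have "0 \<le> L (specialize Y r (\<sigma> i * f i))" if "i \<in> {1..s}" for i
    using m(2) gens[OF that] that by (intro weighted) auto
  ultimately show ?thesis
    unfolding m(1) specialize_hom(1) specialize_sum add sum mult_1_right
    by (intro add_nonneg_nonneg sum_nonneg)
qed

lemma seq_closure_subset_double_dual: "seq_closure M \<subseteq> double_dual M"
proof
  fix f assume "f \<in> seq_closure M"
  then obtain q where q: "\<And>\<epsilon>. 0 < \<epsilon> \<Longrightarrow> f + Cst \<epsilon> * q \<in> M" by (auto simp: seq_closure_def)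
  show "f \<in> double_dual M"
    unfolding double_dual_def
  proof (intro CollectI allI impI)
    fix L assume L: "linear_functional L \<and> (\<forall>m\<in>M. 0 \<le> L m)"
    have *: "0 \<le> L f + \<epsilon> * L q" if "0 < \<epsilon>" for \<epsilon>
      using L q[OF that] by (metis linear_functional_iff)
    show "0 \<le> L f"
    proof (rule field_le_epsilon)
      fix \<delta> :: real assume "0 < \<delta>"
      define \<epsilon> where "\<epsilon> = \<delta> / (1 + \<bar>L q\<bar>)"
      have "0 < \<epsilon>" "\<epsilon> * \<bar>L q\<bar> \<le> \<delta>" using \<open>0 < \<delta>\<close> by (auto simp: \<epsilon>_def field_simps)
      moreover have "\<epsilon> * L q \<le> \<epsilon> * \<bar>L q\<bar>" using \<open>0 < \<epsilon>\<close> by (intro mult_left_mono) auto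
      ultimately show "0 \<le> L f + \<delta>" using *[of \<epsilon>] by linarith
    qed
  qed
qed

lemma ex_deg_le_all: "\<exists>d. \<forall>i\<in>{1..s}. f i \<in> deg_le Y d" for s :: nat
proof (induction s)
  case (Suc s)
  then obtain d where d: "\<forall>i\<in>{1..s}. f i \<in> deg_le Y d" by blast
  obtain k where k: "f (Suc s) \<in> deg_le Y k" using ex_deg_le[of "f (Suc s)" Y] by blast
  have "f i \<in> deg_le Y (max d k)" if "i \<in> {1..Suc s}" for i
  proof (cases "i = Suc s")
    case True
    then show ?thesis using deg_le_mono[OF k] by simp
  next
    case False
    then have "f i \<in> deg_le Y d" using d that by simp
    then show ?thesis by (rule deg_le_mono) simp
  qed
  then show ?case by blast
qed simp

theorem corollary5p2:
  fixes Y :: "'v::finite" and s :: nat and f :: "nat \<Rightarrow> 'v rpoly" and N :: real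
  assumes "N > 0"
    and "Cst N - (\<Sum>i\<in>UNIV - {Y}. (Var i)\<^sup>2) \<in> QM s f"
    and "\<And>r :: 'v \<Rightarrow> real. fibre s f Y r = {} \<or> \<not> bounded (fibre s f Y r)"
  shows "seq_closure (QM s f) = double_dual (QM s f)"
proof
  let ?M = "QM s f"
  note M = quadratic_module_QM[of s f]
  show "seq_closure ?M \<subseteq> double_dual ?M" by (rule seq_closure_subset_double_dual)
  show "double_dual ?M \<subseteq> seq_closure ?M"
  proof
    fix u assume u: "u \<in> double_dual ?M"
    obtain d where d: "\<And>i. i \<in> {1..s} \<Longrightarrow> f i \<in> deg_le Y d" using ex_deg_le_all[of s f Y] by blast
    obtain e where e: "u \<in> deg_le Y e" using ex_deg_le[of u Y] by blast
    \<comment> \<open>\<open>D\<close> exceeds the number of weights on a fibre times their degree, as the quadrature argument over an empty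
      fibre asks, and also the degree of \<open>u\<close>; the slack \<open>d\<close> in \<open>h\<close> leaves room for one factor \<open>f i\<close>, even over
      points \<open>r\<close> where its degree drops.\<close>
    define D where "D = (s + 1) * d + 1 + e"
    define h where "h = D + d"
    have "u + Cst \<epsilon> * Y_squares Y h \<in> ?M" if "0 < \<epsilon>" for \<epsilon>
    proof (rule ccontr)
      assume notin: "u + Cst \<epsilon> * Y_squares Y h \<notin> ?M"
      have "u \<in> deg_le Y (2 * h)" by (rule deg_le_mono[OF e]) (simp add: h_def D_def)
      then obtain r \<Lambda> where \<Lambda>: "poly_functional \<Lambda>" "\<Lambda> (specialize Y r u) < 0"
        "\<forall>p\<in>?M \<inter> deg_le Y (2 * h). 0 \<le> \<Lambda> (specialize Y r p)"
        using fibre_functional[OF M assms(1,2) _ notin \<open>0 < \<epsilon>\<close>] by blast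
      interpret poly_functional \<Lambda> by fact
      let ?sp = "specialize Y r"
      \<comment> \<open>The weight \<open>1\<close> stands for the unweighted sums of squares.\<close>
      define F where "F = insert 1 (?sp ` f ` {1..s}) - {0}"
      have F: "finite F" "0 \<notin> F" by (auto simp: F_def)
      have "card F \<le> card (insert 1 (?sp ` f ` {1..s}))" unfolding F_def by (intro card_mono) auto
      also have "\<dots> \<le> Suc (card (?sp ` f ` {1..s}))" by (rule card_insert_le_m1) auto
      also have "card (?sp ` f ` {1..s}) \<le> s"
        using card_image_le[of "f ` {1..s}" ?sp] card_image_le[of "{1..s}" f] by simp
      finally have cardF: "card F \<le> s + 1" by simp
      have F_cases: "p = 1 \<or> (\<exists>i\<in>{1..s}. p = ?sp (f i))" if "p \<in> F" for p
        using that by (auto simp: F_def)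
      have degF: "degree p \<le> d" if "p \<in> F" for p
        using F_cases[OF that] degree_specialize_le[OF d] by fastforce
      have feasible: "{y. \<forall>p\<in>F. 0 \<le> poly p y} = fibre s f Y r"
        unfolding fibre_eq F_def by fastforce
      have squares: "0 \<le> \<Lambda> (g * g)" if "2 * degree g \<le> 2 * h" for g
      proof -
        have "(inject_Y Y g)\<^sup>2 \<in> deg_le Y (2 * degree g)" by (rule deg_le_power[OF inject_Y_deg_le])
        then have "(inject_Y Y g)\<^sup>2 \<in> ?M \<inter> deg_le Y (2 * h)"
          using quadratic_moduleD(3)[OF M, of "inject_Y Y g"] deg_le_mono[OF _ that] by simp
        then have "0 \<le> \<Lambda> (?sp ((inject_Y Y g)\<^sup>2))" using \<Lambda>(3) by blast
        then show ?thesis by (simp add: specialize_hom specialize_inject_Y power2_eq_square)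
      qed
      have weighted: "0 \<le> \<Lambda> (g * g * p)" if "p \<in> F" "2 * degree g + d \<le> 2 * h" for g p
        using F_cases[OF that(1)]
      proof
        assume "p = 1"
        then show ?thesis using squares[of g] that(2) by simp
      next
        assume "\<exists>i\<in>{1..s}. p = ?sp (f i)"
        then obtain i where i: "i \<in> {1..s}" "p = ?sp (f i)" by blast
        have "(inject_Y Y g)\<^sup>2 * f i \<in> deg_le Y (2 * degree g + d)"
          by (intro deg_le_mult deg_le_power inject_Y_deg_le d i)
        then have "(inject_Y Y g)\<^sup>2 * f i \<in> ?M \<inter> deg_le Y (2 * h)"
          using quadratic_moduleD(2)[OF M generator_in_QM[OF i(1)]] deg_le_mono[OF _ that(2)] by simp
        then have "0 \<le> \<Lambda> (?sp ((inject_Y Y g)\<^sup>2 * f i))" using \<Lambda>(3) by blast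
        then show ?thesis by (simp add: i specialize_hom specialize_inject_Y power2_eq_square)
      qed
      have degu: "degree (?sp u) \<le> e" by (rule degree_specialize_le[OF e])
      from assms(3)[of r] show False
      proof
        assume empty: "fibre s f Y r = {}"
        have "\<Lambda> (?sp u) = 0"
        proof (rule vanishes_if_infeasible[OF F(1) degF, where D = D])
          show "\<exists>p\<in>F. poly p y < 0" for y
            using empty feasible by (force simp: not_le)
          have "card F * d \<le> (s + 1) * d" using cardF by (rule mult_right_mono) simp
          then show "card F * d < D" by (simp add: D_def)
          show "0 \<le> \<Lambda> (g * g)" if "g \<in> below (D + d + 1)" for g
            using that by (intro squares) (auto simp: below_iff h_def)
          show "0 \<le> \<Lambda> (g * g * p)" if "p \<in> F" "g \<in> below D" for g p
            using that(2) by (intro weighted that) (auto simp: below_iff h_def)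
          show "?sp u \<in> below (D + d + 1)" using degu by (auto simp: below_iff D_def)
        qed
        then show False using \<Lambda>(2) by simp
      next
        assume unb: "\<not> bounded (fibre s f Y r)"
        have nonneg: "0 \<le> \<Lambda> (g * g * p)" if "p \<in> F" "2 * degree g + degree p \<le> e" for p g
          using that(2) by (intro weighted that) (simp add: h_def D_def)
        show False
        proof (rule extend_if_unbounded[OF F _ nonneg degu \<Lambda>(2)])
          show "\<not> bounded {y. \<forall>p\<in>F. 0 \<le> poly p y}" using unb by (simp add: feasible)
        next
          fix L' assume L': "poly_functional L'" "\<And>p g. p \<in> F \<Longrightarrow> 0 \<le> L' (g * g * p)" "L' (?sp u) < 0"
          interpret L': poly_functional L' by fact
          have "0 \<le> L' (?sp m)" if "m \<in> ?M" for m
          proof (rule nonneg_on_QM[OF L'(1) _ _ that])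
            show "0 \<le> L' (g * g)" for g using L'(2)[of 1 g] by (simp add: F_def)
            show "0 \<le> L' (g * g * ?sp (f i))" if "i \<in> {1..s}" for i g
              using L'(2)[of "?sp (f i)" g] that by (cases "?sp (f i) = 0") (auto simp: F_def)
          qed
          moreover have "linear_functional (\<lambda>p. L' (?sp p))"
            by (simp add: linear_functional_iff specialize_hom(1) specialize_Cst_times L'.add L'.smult)
          ultimately have "0 \<le> L' (?sp u)" using u unfolding double_dual_def by blast
          then show False using L'(3) by simp
        qed
      qed
    qed
    then show "u \<in> seq_closure ?M" by (auto simp: seq_closure_def)
  qed
qed

end
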